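(* Let $p>2$ be an odd prime, $G'$ a finite group of order prime to $p$, $H'$ a subgroup of $G'$, and $(V,\rho)$ an $H'$-extremal $\mathbb{F}_p$-representation of $G'$. Put $\overline{G}:=\rho(G')$ and $\overline{H}:=\rho(H')$. (i) One of the following holds: (1) $\overline{G}\cong C_{d}$ and $\overline{H}=\{1\}$, where $d\geq3$ is a divisor of $p-1$ or of $p+1$; (2) $\overline{G}\cong D_{d'}$ and $\#\overline{H}\leq 2$, where $d'\geq3$ is an odd divisor of $p-1$ or of $p+1$. (ii) If $\#\overline{G}$ is a multiple of $4$ and $s:=\mathrm{ord}_{2}(\#\overline{G})\geq 2$, then $p\equiv 1\bmod 2^{s}$ and $\overline{G}$ is cyclic.
   Context: An $\mathbb{F}_p$-representation $(V,\rho)$ of $G'$ is $H'$-extremal if $\dim_{\mathbb{F}_p}V=2$, $V^{G'}=\{0\}$, and there is a 1-dimensional subspace $L\subset V$ with $H'\subset\mathrm{Stab}_{G'}(L)=\mathrm{Fix}_{G'}(L)$ (stabilizer and pointwise stabilizer). $C_n$ is cyclic of order $n$, $D_n$ dihedral of order $2n$; $\mathrm{ord}_2$ is the $2$-adic valuation. *)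

theory Defs
  imports
    "HOL-Algebra.Elementary_Groups"
    "HOL-Number_Theory.Cong"
    "Berlekamp_Zassenhaus.Finite_Field"
begin

text \<open>
  A vector space is a whole type \<^typ>\<open>'v\<close> with a scalar multiplication \<open>scale\<close>
  satisfying the locale \<^locale>\<open>vector_space\<close>. The prime field with \<open>p\<close> elements is
  \<^typ>\<open>'p::prime_card mod_ring\<close>, where \<open>p = CARD('p)\<close>.
\<close>

definition general_linear_group ::
    "('k::field \<Rightarrow> 'v::ab_group_add \<Rightarrow> 'v) \<Rightarrow> ('v \<Rightarrow> 'v) monoid" where
  "general_linear_group scale =
     \<lparr>carrier = {f. Vector_Spaces.linear scale scale f \<and> bij f}, monoid.mult = (\<circ>), one = id\<rparr>"

definition group_representation ::
    "('g, 'm) monoid_scheme \<Rightarrow> ('k::field \<Rightarrow> 'v::ab_group_add \<Rightarrow> 'v) \<Rightarrow> ('g \<Rightarrow> 'v \<Rightarrow> 'v) \<Rightarrow> bool" where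
  "group_representation G scale \<rho> \<longleftrightarrow>
     group G \<and> vector_space scale \<and> \<rho> \<in> hom G (general_linear_group scale)"

definition invariants :: "('g, 'm) monoid_scheme \<Rightarrow> ('g \<Rightarrow> 'v \<Rightarrow> 'v) \<Rightarrow> 'v set" where
  "invariants G \<rho> = {v. \<forall>g \<in> carrier G. \<rho> g v = v}"

definition setwise_stabilizer ::
    "('g, 'm) monoid_scheme \<Rightarrow> ('g \<Rightarrow> 'v \<Rightarrow> 'v) \<Rightarrow> 'v set \<Rightarrow> 'g set" where
  "setwise_stabilizer G \<rho> L = {g \<in> carrier G. \<rho> g ` L = L}"

definition pointwise_stabilizer ::
    "('g, 'm) monoid_scheme \<Rightarrow> ('g \<Rightarrow> 'v \<Rightarrow> 'v) \<Rightarrow> 'v set \<Rightarrow> 'g set" where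
  "pointwise_stabilizer G \<rho> L = {g \<in> carrier G. \<forall>v \<in> L. \<rho> g v = v}"

definition extremal_representation ::
    "('g, 'm) monoid_scheme \<Rightarrow> 'g set \<Rightarrow> ('k::field \<Rightarrow> 'v::ab_group_add \<Rightarrow> 'v) \<Rightarrow>
     ('g \<Rightarrow> 'v \<Rightarrow> 'v) \<Rightarrow> bool" where
  "extremal_representation G H scale \<rho> \<longleftrightarrow>
     group_representation G scale \<rho> \<and>
     vector_space.dim scale (UNIV :: 'v set) = 2 \<and>
     invariants G \<rho> = {0} \<and>
     (\<exists>L. module.subspace scale L \<and> vector_space.dim scale L = 1 \<and>
          H \<subseteq> setwise_stabilizer G \<rho> L \<and>
          setwise_stabilizer G \<rho> L = pointwise_stabilizer G \<rho> L)"

definition representation_image ::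
    "('g, 'm) monoid_scheme \<Rightarrow> ('k::field \<Rightarrow> 'v::ab_group_add \<Rightarrow> 'v) \<Rightarrow> ('g \<Rightarrow> 'v \<Rightarrow> 'v) \<Rightarrow>
     ('v \<Rightarrow> 'v) monoid" where
  "representation_image G scale \<rho> = (general_linear_group scale)\<lparr>carrier := \<rho> ` carrier G\<rparr>"

text \<open>
  The dihedral group of order \<open>2n\<close> for \<open>n \<ge> 1\<close>, as the semidirect product of the integers modulo \<open>n\<close>
  by the inversion: with \<open>r\<close> the generating rotation and \<open>s\<close> a reflection, \<open>(a, False)\<close> stands for
  \<open>r^a\<close> and \<open>(a, True)\<close> for \<open>r^a s\<close>, and \<open>s r s = r^(-1)\<close>.
\<close>

definition dihedral_group :: "nat \<Rightarrow> (int \<times> bool) monoid" where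
  "dihedral_group n =
     \<lparr>carrier = {0..<int n} \<times> UNIV,
      monoid.mult = (\<lambda>(a, x) (b, y). ((if x then a - b else a + b) mod int n, x \<noteq> y)),
      one = (0, False)\<rparr>"

lemma group_general_linear_group:
  assumes "vector_space scale"
  shows "group (general_linear_group scale)"
proof -
  interpret V: vector_space scale by fact
  show ?thesis
  proof (rule groupI)
    fix f assume "f \<in> carrier (general_linear_group scale)"
    then have f: "Vector_Spaces.linear scale scale f" "bij f"
      by (auto simp: general_linear_group_def)
    interpret f: Vector_Spaces.linear scale scale f by (fact f)
    have fi: "f (inv_into UNIV f y) = y" for y
      using f(2) by (simp add: bij_is_surj surj_f_inv_f)
    have eq: "inv_into UNIV f y = x" if "f x = y" for x y
      using that f(2) by (auto simp: bij_is_inj)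
    have "Vector_Spaces.linear scale scale (inv_into UNIV f)"
      unfolding Vector_Spaces.linear_iff
      by (auto intro!: eq simp: f.add f.scale fi V.vector_space_axioms)
    moreover have "bij (inv_into UNIV f)" "inv_into UNIV f \<circ> f = id"
      using f by (auto simp: bij_imp_bij_inv bij_is_inj)
    ultimately show "\<exists>g \<in> carrier (general_linear_group scale).
        g \<otimes>\<^bsub>general_linear_group scale\<^esub> f = \<one>\<^bsub>general_linear_group scale\<^esub>"
      by (auto simp: general_linear_group_def)
  qed (auto simp: general_linear_group_def V.linear_id intro: bij_comp Vector_Spaces.linear_compose)
qed

lemma group_representation_image:
  assumes "group_representation G scale \<rho>"
  shows "group (representation_image G scale \<rho>)"
proof -
  have "group_hom G (general_linear_group scale) \<rho>"
    using assms by (simp add: group_representation_def group_hom_def group_hom_axioms_def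
        group_general_linear_group)
  then show ?thesis
    unfolding representation_image_def
    by (metis group_hom.img_is_subgroup group_general_linear_group assms
        group_representation_def subgroup.subgroup_is_group)
qed

lemma group_dihedral_group:
  assumes "n > 0"
  shows "group (dihedral_group n)"
proof (rule groupI)
  fix u assume "u \<in> carrier (dihedral_group n)"
  then obtain a x where u: "u = (a, x)" "0 \<le> a" "a < int n"
    by (auto simp: dihedral_group_def)
  then show "\<exists>w \<in> carrier (dihedral_group n).
      w \<otimes>\<^bsub>dihedral_group n\<^esub> u = \<one>\<^bsub>dihedral_group n\<^esub>"
    using assms
    by (intro bexI[of _ "(if x then a else (- a) mod int n, x)"])
       (auto simp: dihedral_group_def mod_simps)
next
  fix u v w
  show "u \<otimes>\<^bsub>dihedral_group n\<^esub> v \<otimes>\<^bsub>dihedral_group n\<^esub> w =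
      u \<otimes>\<^bsub>dihedral_group n\<^esub> (v \<otimes>\<^bsub>dihedral_group n\<^esub> w)"
    by (cases u; cases v; cases w) (simp add: dihedral_group_def mod_simps algebra_simps)
qed (use assms in \<open>auto simp: dihedral_group_def\<close>)

lemma order_dihedral_group: "Coset.order (dihedral_group n) = 2 * n"
  by (simp add: Coset.order_def dihedral_group_def card_cartesian_product)

end

theory Submission
  imports Defs "HOL-Algebra.Algebraic_Closure_Type"
begin

text \<open>
  In a basis whose first vector spans \<open>L\<close>, the image of the representation is a group \<open>S\<close> of
  2x2 matrices. Scalar matrices stabilize \<open>L\<close>, so the identity is the only scalar in \<open>S\<close>.
  Let \<open>N\<close> be the subgroup of determinant 1. If \<open>N\<close> is trivial, the determinant embeds \<open>S\<close> into
  the cyclic group of units of the prime field.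

  Otherwise \<open>N\<close> is abelian: squaring is injective on \<open>N\<close> by Cayley-Hamilton, hence
  \<open>\<Sum>(tr A)\<^sup>2 - 2 |N| = \<Sum>tr (A\<^sup>2) = \<Sum>tr A = 0\<close>, whereas by Schur orthogonality \<open>\<Sum>(tr A)\<^sup>2\<close> would
  be \<open>|N|\<close> if only scalars commuted with \<open>N\<close>. Fix \<open>Z \<noteq> 1\<close> in \<open>N\<close>. A conjugate of \<open>Z\<close> under
  \<open>S\<close> lies in \<open>k[Z]\<close> and has the same characteristic polynomial, so it is \<open>Z\<close> or its inverse. The
  centralizer of \<open>Z\<close> in \<open>S\<close> embeds into the units of an algebraic closure by the ratio of the
  eigenvalues, so it is cyclic of order dividing \<open>p - 1\<close> or \<open>p + 1\<close>. An element \<open>w\<close> outside it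
  inverts it, because \<open>A (w A w\<^sup>-\<^sup>1) = det A\<close> is a scalar of \<open>S\<close>; similarly \<open>w\<^sup>2 = 1\<close>,
  and \<open>S\<close> is dihedral.
\<close>

hide_const (open) Divisibility.prime

section \<open>Cyclic and dihedral groups\<close>

lemma (in comm_group) ord_mult_coprime:
  assumes x: "x \<in> carrier G" and y: "y \<in> carrier G" and "coprime (ord x) (ord y)"
  shows "ord (x \<otimes> y) = ord x * ord y"
proof (rule dvd_antisym)
  show "ord (x \<otimes> y) dvd ord x * ord y"
    by (rule abelian_ord_mul_divides[OF x y])
  \<comment> \<open>Raising \<open>(u \<otimes> v) [^] n = \<one>\<close> to the power
    \<open>ord v\<close> kills the factor \<open>v\<close> and leaves \<open>u\<close>. Coprimality
    later cancels the extra factor.\<close>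
  have *: "ord u dvd n * ord v"
    if "u \<in> carrier G" "v \<in> carrier G" "(u \<otimes> v) [^] n = \<one>" for u v and n :: nat
  proof -
    have "(u \<otimes> v) [^] (n * ord v) = u [^] (n * ord v) \<otimes> v [^] (n * ord v)"
      using that by (simp add: nat_pow_distrib)
    moreover have "v [^] (n * ord v) = \<one>"
      using that by (simp add: pow_eq_id)
    moreover have "(u \<otimes> v) [^] (n * ord v) = \<one>"
      using that by (simp flip: nat_pow_pow)
    ultimately have "u [^] (n * ord v) = \<one>" using that by simp
    then show ?thesis using that by (simp add: pow_eq_id)
  qed
  let ?n = "ord (x \<otimes> y)"
  have "(x \<otimes> y) [^] ?n = \<one>" "(y \<otimes> x) [^] ?n = \<one>"
    using x y by (simp_all add: m_comm[of y x])
  then have "ord x dvd ?n * ord y" "ord y dvd ?n * ord x"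
    using * x y by blast+
  then have "ord x dvd ?n" "ord y dvd ?n"
    using assms(3) by (simp_all add: coprime_dvd_mult_left_iff coprime_commute)
  then show "ord x * ord y dvd ?n"
    using assms(3) by (simp add: divides_mult)
qed

text \<open>An element \<open>g\<close> of maximal order works. If some prime \<open>q\<close>
  divided \<open>ord h\<close> to a higher power than \<open>ord g\<close>, replacing the
  \<open>q\<close>-part of \<open>g\<close> by that of \<open>h\<close> would produce an element of
  larger order.\<close>

lemma (in comm_group) ex_ord_exponent:
  assumes fin: "finite (carrier G)"
  obtains g where "g \<in> carrier G" "\<And>h. h \<in> carrier G \<Longrightarrow> ord h dvd ord g"
proof -
  have "finite (ord ` carrier G)" "ord ` carrier G \<noteq> {}"
    using fin by auto
  then have "Max (ord ` carrier G) \<in> ord ` carrier G" by (rule Max_in)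
  then obtain g where g: "g \<in> carrier G" "ord g = Max (ord ` carrier G)" by (metis imageE)
  then have max: "ord h \<le> ord g" if "h \<in> carrier G" for h
    using that fin by simp
  have pos: "ord h > 0" if "h \<in> carrier G" for h
    using ord_ge_1[OF fin that] by simp
  have "ord h dvd ord g" if h: "h \<in> carrier G" for h
  proof (rule multiplicity_le_imp_dvd)
    show "ord h \<noteq> 0" using pos h by auto
    fix q :: nat assume q: "prime q"
    show "multiplicity q (ord h) \<le> multiplicity q (ord g)"
    proof (rule ccontr)
      assume less: "\<not> ?thesis"
      define a b where "a = multiplicity q (ord g)" and "b = multiplicity q (ord h)"
      obtain m where m: "ord g = q ^ a * m" "\<not> q dvd m"
        using multiplicity_decompose'[of "ord g" q] pos[OF g(1)] q
        by (metis a_def gr_implies_not0 not_prime_unit)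
      obtain k where k: "ord h = q ^ b * k"
        using multiplicity_dvd[of q "ord h"] by (auto simp: b_def dvd_def)
      have nz: "q ^ a > 0" "m > 0" "k > 0"
        using pos[OF g(1)] pos[OF h] q m k by (auto simp: prime_gt_0_nat intro!: Nat.gr0I)
      have "ord (g [^] (q ^ a)) = m" "ord (h [^] k) = q ^ b"
        using ord_pow[of g "q ^ a"] ord_pow[of h k] g(1) h m k nz by auto
      moreover have "coprime m (q ^ b)"
        using prime_imp_coprime[OF q m(2)] by (simp add: coprime_commute)
      ultimately have "ord (g [^] (q ^ a) \<otimes> h [^] k) = m * q ^ b"
        using ord_mult_coprime[of "g [^] (q ^ a)" "h [^] k"] g h by simp
      then have "m * q ^ b \<le> q ^ a * m"
        using max[of "g [^] (q ^ a) \<otimes> h [^] k"] g h m by simp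
      moreover have "q ^ a < q ^ b"
        using less prime_gt_1_nat[OF q] by (intro power_strict_increasing) (auto simp: a_def b_def)
      ultimately show False using nz by (simp add: mult.commute)
    qed
  qed
  then show ?thesis using that g(1) by blast
qed

lemma card_roots_of_unity_le:
  assumes "n > 0"
  shows "finite {u::'k::idom. u ^ n = 1}" "card {u::'k::idom. u ^ n = 1} \<le> n"
proof -
  define P :: "'k poly" where "P = monom 1 n - 1"
  have "coeff P n = 1"
    using assms by (simp add: P_def)
  then have P: "P \<noteq> 0" by auto
  have "Polynomial.degree P \<le> n"
    unfolding P_def by (intro degree_diff_le) (auto simp: degree_monom_le)
  moreover have "{u. poly P u = 0} = {u. u ^ n = 1}"
    by (auto simp: P_def poly_monom)
  ultimately show "finite {u::'k::idom. u ^ n = 1}" "card {u::'k::idom. u ^ n = 1} \<le> n"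
    using poly_roots_finite[OF P] card_poly_roots_bound[OF P] by auto
qed

text \<open>The embedding makes the group commutative, so some \<open>g\<close> has the exponent as
  its order. All values of \<open>f\<close> are then roots of \<open>X^(ord g) - 1\<close>, and the
  bound on the number of roots gives \<open>|G| \<le> ord g\<close>.\<close>

lemma (in group) ex_generator_if_embeds_in_field:
  fixes f :: "'a \<Rightarrow> 'k::field"
  assumes fin: "finite (carrier G)" and inj: "inj_on f (carrier G)"
    and mult: "\<And>x y. x \<in> carrier G \<Longrightarrow> y \<in> carrier G \<Longrightarrow> f (x \<otimes> y) = f x * f y"
    and nz: "f \<one> \<noteq> 0"
  obtains g where "g \<in> carrier G" "ord g = Coset.order G"
proof -
  have f1: "f \<one> = 1"
    using mult[of \<one> \<one>] nz by simp
  have "x \<otimes> y = y \<otimes> x" if "x \<in> carrier G" "y \<in> carrier G" for x y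
    using that by (intro inj_onD[OF inj]) (auto simp: mult mult.commute)
  then interpret comm_group G
    by (intro group_comm_groupI) auto
  obtain g where g: "g \<in> carrier G" "\<And>h. h \<in> carrier G \<Longrightarrow> ord h dvd ord g"
    using ex_ord_exponent[OF fin] by blast
  have pow: "f (x [^] n) = f x ^ n" if "x \<in> carrier G" for x and n :: nat
    using that by (induction n) (auto simp: f1 mult)
  have pos: "ord g > 0"
    using ord_ge_1[OF fin g(1)] by simp
  have "f x ^ ord g = 1" if "x \<in> carrier G" for x
  proof -
    have "x [^] ord g = \<one>" using g that by (simp add: pow_eq_id)
    then show ?thesis using pow[OF that, of "ord g"] f1 by simp
  qed
  then have "f ` carrier G \<subseteq> {u. u ^ ord g = 1}" by auto
  then have "card (f ` carrier G) \<le> ord g"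
    using card_roots_of_unity_le[OF pos, where 'k = 'k] card_mono order_trans by blast
  then have "Coset.order G \<le> ord g"
    by (simp add: card_image[OF inj] Coset.order_def)
  then show ?thesis
    using that g(1) ord_le_group_order[OF fin g(1)] by simp
qed

text \<open>The power at half the order is the witness. It serves contrapositively: a cyclic group
  without involutions has odd order.\<close>

lemma (in group) generator_involution:
  assumes "g \<in> carrier G" "even (ord g)" "ord g > 0"
  obtains z where "z \<in> carrier G" "z \<otimes> z = \<one>" "z \<noteq> \<one>"
proof
  let ?z = "g [^] (ord g div 2)"
  show "?z \<in> carrier G" using assms by simp
  have "?z \<otimes> ?z = g [^] (ord g div 2 + ord g div 2)"
    using assms by (simp add: nat_pow_mult)
  also have "ord g div 2 + ord g div 2 = ord g" using assms(2) by auto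
  finally show "?z \<otimes> ?z = \<one>" using assms by simp
  show "?z \<noteq> \<one>"
  proof
    assume "?z = \<one>"
    then have "ord g dvd ord g div 2" using assms by (simp add: pow_eq_id)
    then show False using assms by (auto dest!: dvd_imp_le)
  qed
qed

section \<open>Recognizing cyclic and dihedral groups from generators\<close>

lemma (in group) int_pow_mod_ord:
  assumes "g \<in> carrier G"
  shows "g [^] (a mod int (ord g)) = g [^] (a :: int)"
  using assms by (simp add: int_pow_eq)

lemma (in group) inj_on_int_powers:
  assumes "g \<in> carrier G"
  shows "inj_on (\<lambda>a::int. g [^] a) {0..<int (ord g)}"
proof (rule inj_onI)
  fix a b :: int
  assume ab: "a \<in> {0..<int (ord g)}" "b \<in> {0..<int (ord g)}" and "g [^] a = g [^] b"
  then have "int (ord g) dvd b - a" using assms by (simp add: int_pow_eq)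
  then have "b mod int (ord g) = a mod int (ord g)" by (simp only: mod_eq_dvd_iff)
  then show "a = b" using ab by simp
qed

lemma (in group) carrier_eq_int_powers:
  assumes fin: "finite (carrier G)" and g: "g \<in> carrier G" "ord g = Coset.order G"
  shows "bij_betw (\<lambda>a::int. g [^] a) {0..<int (Coset.order G)} (carrier G)"
proof -
  have inj: "inj_on (\<lambda>a::int. g [^] a) {0..<int (Coset.order G)}"
    using inj_on_int_powers[OF g(1)] g(2) by simp
  have "(\<lambda>a::int. g [^] a) ` {0..<int (Coset.order G)} \<subseteq> carrier G"
    using g by auto
  moreover have "card ((\<lambda>a::int. g [^] a) ` {0..<int (Coset.order G)}) = card (carrier G)"
    using card_image[OF inj] by (simp add: Coset.order_def)
  ultimately show ?thesis
    using card_subset_eq[OF fin] inj by (auto simp: bij_betw_def)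
qed

lemma (in group) iso_integer_mod_group:
  assumes fin: "finite (carrier G)" and g: "g \<in> carrier G" "ord g = Coset.order G"
  shows "G \<cong> integer_mod_group (Coset.order G)"
proof -
  have pos: "Coset.order G > 0" using fin order_gt_0_iff_finite by blast
  have "(\<lambda>a::int. g [^] a) \<in> iso (integer_mod_group (Coset.order G)) G"
    using carrier_eq_int_powers[OF assms] pos g
    by (auto simp: iso_def hom_def carrier_integer_mod_group int_pow_mult
        int_pow_mod_ord[OF g(1), unfolded g(2)])
  then show ?thesis
    using group.iso_sym[OF group_integer_mod_group] is_isoI by blast
qed

text \<open>The isomorphism sends \<open>(a, x)\<close> to \<open>r^a w^x\<close>. The relation
  \<open>wr\<close> makes it multiplicative, \<open>gen\<close> makes it surjective, and
  \<open>nw\<close> keeps rotations and reflections apart.\<close>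

lemma (in group) iso_dihedral_group:
  assumes fin: "finite (carrier G)" and r: "r \<in> carrier G" and w: "w \<in> carrier G"
    and ww: "w \<otimes> w = \<one>" and wr: "w \<otimes> r \<otimes> w = inv r"
    and gen: "\<And>g. g \<in> carrier G \<Longrightarrow> \<exists>a::int. g = r [^] a \<or> g = r [^] a \<otimes> w"
    and nw: "\<And>a::int. w \<noteq> r [^] a"
  shows "G \<cong> dihedral_group (ord r)"
proof -
  have pos: "ord r > 0" using ord_ge_1[OF fin r] by simp
  have winv: "inv w = w" using ww w by (simp add: inv_equality)
  \<comment> \<open>Inserting \<open>w \<otimes> w = \<one>\<close> between the factors splits the
    conjugate of a power into conjugates of \<open>r\<close>.\<close>
  have wrn: "w \<otimes> r [^] n \<otimes> w = r [^] (- int n)" for n :: nat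
  proof (induction n)
    case (Suc n)
    have "w \<otimes> r [^] Suc n \<otimes> w = w \<otimes> r [^] n \<otimes> (w \<otimes> w) \<otimes> r \<otimes> w"
      using r w by (simp add: m_assoc ww)
    also have "\<dots> = (w \<otimes> r [^] n \<otimes> w) \<otimes> (w \<otimes> r \<otimes> w)"
      using r w by (simp add: m_assoc)
    also have "\<dots> = r [^] (- int n) \<otimes> r [^] (-1 :: int)"
      using r by (simp add: Suc.IH wr int_pow_neg)
    also have "\<dots> = r [^] (- int (Suc n))"
      using int_pow_mult[OF r, of "- int n" "-1"] by (simp add: algebra_simps)
    finally show ?case .
  qed (use w ww in auto)
  have wra: "w \<otimes> r [^] a = r [^] (- a) \<otimes> w" for a :: int
  proof -
    have *: "w \<otimes> r [^] a \<otimes> w = r [^] (- a)"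
    proof (cases a rule: int_cases2)
      case (nonneg n)
      then show ?thesis using wrn by (simp add: int_pow_int)
    next
      \<comment> \<open>A negative power of \<open>r\<close> is already the conjugate of a positive
        one, and conjugating twice is the identity.\<close>
      case (nonpos n)
      have "w \<otimes> r [^] a \<otimes> w = w \<otimes> (w \<otimes> r [^] n \<otimes> w) \<otimes> w"
        using nonpos wrn by simp
      also have "\<dots> = (w \<otimes> w) \<otimes> r [^] n \<otimes> (w \<otimes> w)"
        using r w by (simp add: m_assoc)
      finally show ?thesis using nonpos r ww by (simp add: int_pow_int)
    qed
    have "w \<otimes> r [^] a = w \<otimes> r [^] a \<otimes> (w \<otimes> w)" using r w ww by simp
    also have "\<dots> = (w \<otimes> r [^] a \<otimes> w) \<otimes> w"
      using r w by (simp add: m_assoc)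
    finally show ?thesis using * by simp
  qed
  define h where "h = (\<lambda>(a::int, x). if x then r [^] a \<otimes> w else r [^] a)"
  have mod: "r [^] (a mod int (ord r)) = r [^] a" for a :: int
    by (rule int_pow_mod_ord[OF r])
  have hom: "h \<in> hom (dihedral_group (ord r)) G"
  proof (rule homI)
    fix u assume "u \<in> carrier (dihedral_group (ord r))"
    then show "h u \<in> carrier G" using r w by (auto simp: h_def split: prod.split)
  next
    fix u v :: "int \<times> bool"
    obtain a x b y where uv: "u = (a, x)" "v = (b, y)" by fastforce
    have "r [^] a \<otimes> w \<otimes> r [^] b = r [^] a \<otimes> (r [^] (- b) \<otimes> w)"
      using r w wra[of b] by (simp add: m_assoc)
    also have "\<dots> = r [^] a \<otimes> r [^] (- b) \<otimes> w"
      using r w by (simp add: m_assoc)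
    also have "\<dots> = r [^] (a - b) \<otimes> w"
      using int_pow_mult[OF r, of a "- b"] by simp
    finally have 1: "r [^] a \<otimes> w \<otimes> r [^] b = r [^] (a - b) \<otimes> w" .
    have "r [^] a \<otimes> w \<otimes> (r [^] b \<otimes> w) = r [^] a \<otimes> w \<otimes> r [^] b \<otimes> w"
      using r w by (simp add: m_assoc)
    also have "\<dots> = r [^] (a - b) \<otimes> (w \<otimes> w)"
      using r w by (simp only: 1 m_assoc int_pow_closed)
    finally have 2: "r [^] a \<otimes> w \<otimes> (r [^] b \<otimes> w) = r [^] (a - b)"
      using r ww by simp
    have 3: "r [^] (a + b) = r [^] a \<otimes> r [^] b" using r by (rule int_pow_mult)
    have 4: "r [^] a \<otimes> (r [^] b \<otimes> w) = r [^] a \<otimes> r [^] b \<otimes> w" using r w by (simp add: m_assoc)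
    show "h (u \<otimes>\<^bsub>dihedral_group (ord r)\<^esub> v) = h u \<otimes> h v"
      by (cases x; cases y) (simp_all add: uv h_def dihedral_group_def mod 1 2 3 4)
  qed
  have inj: "inj_on h (carrier (dihedral_group (ord r)))"
  proof (rule inj_onI)
    fix u v assume uv: "u \<in> carrier (dihedral_group (ord r))" "v \<in> carrier (dihedral_group (ord r))"
      and eq: "h u = h v"
    obtain a x b y where xy: "u = (a, x)" "v = (b, y)" by fastforce
    have bounds: "0 \<le> a" "a < int (ord r)" "0 \<le> b" "b < int (ord r)"
      using uv xy by (auto simp: dihedral_group_def)
    have ab: "a = b" if "r [^] a = r [^] b"
      using that bounds inj_onD[OF inj_on_int_powers[OF r]] by simp
    \<comment> \<open>A rotation equal to a reflection would exhibit \<open>w\<close> as a power of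
      \<open>r\<close>.\<close>
    have ne: "r [^] c \<otimes> w \<noteq> r [^] e" for c e :: int
    proof
      assume "r [^] c \<otimes> w = r [^] e"
      then have "w = inv (r [^] c) \<otimes> r [^] e"
        using r w by (metis int_pow_closed inv_solve_left)
      then have "w = r [^] (- c + e)"
        using int_pow_mult[OF r, of "- c" e] int_pow_neg[OF r, of c] by simp
      then show False using nw by blast
    qed
    have "x = y" using eq ne[of a b] ne[of b a] by (cases x; cases y) (auto simp: xy h_def)
    moreover have "r [^] a = r [^] b"
      using eq \<open>x = y\<close> r w by (cases x) (auto simp: xy h_def)
    ultimately show "u = v" using ab xy by simp
  qed
  have surj: "h ` carrier (dihedral_group (ord r)) = carrier G"
  proof
    show "h ` carrier (dihedral_group (ord r)) \<subseteq> carrier G"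
      using hom by (auto simp: hom_def)
    show "carrier G \<subseteq> h ` carrier (dihedral_group (ord r))"
    proof
      fix g assume "g \<in> carrier G"
      then obtain a :: int where "g = r [^] a \<or> g = r [^] a \<otimes> w" using gen by blast
      then have "g = h (a mod int (ord r), False) \<or> g = h (a mod int (ord r), True)"
        by (auto simp: h_def mod)
      moreover have "(a mod int (ord r), x) \<in> carrier (dihedral_group (ord r))" for x
        using pos by (simp add: dihedral_group_def)
      ultimately show "g \<in> h ` carrier (dihedral_group (ord r))" by blast
    qed
  qed
  have "h \<in> iso (dihedral_group (ord r)) G"
    using hom inj surj by (auto simp: iso_def bij_betw_def)
  then show ?thesis
    using group.iso_sym[OF group_dihedral_group[OF pos]] is_isoI by blast
qed

text \<open>The image is isomorphic to the quotient by the kernel, so its order is the index of the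
  kernel. This carries primality to the characteristic over to the matrix group.\<close>

lemma (in group_hom) card_image_dvd_order: "card (h ` carrier G) dvd Coset.order G"
proof -
  let ?I = "H\<lparr>carrier := h ` carrier G\<rparr>"
  interpret I: group_hom G ?I h
  proof (intro group_hom.intro group_hom_axioms.intro)
    show "group ?I" by (rule subgroup.subgroup_is_group[OF img_is_subgroup H.is_group])
    show "h \<in> hom G ?I" using homh by (auto simp: hom_def)
  qed (rule G.is_group)
  have "G Mod kernel G ?I h \<cong> ?I" by (rule I.FactGroup_iso) simp
  then have "card (carrier (G Mod kernel G ?I h)) = card (h ` carrier G)"
    using iso_same_card by fastforce
  moreover have "card (rcosets (kernel G ?I h)) * card (kernel G ?I h) = Coset.order G"
    by (rule G.lagrange[OF I.subgroup_kernel])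
  ultimately show ?thesis by (metis FactGroup_def partial_object.select_convs(1) dvd_triv_left)
qed

section \<open>Two by two matrices\<close>

text \<open>Four named entries turn each matrix identity into four scalar identities that ring
  normalization settles. Scalar multiplication is written as multiplication by a scalar
  matrix.\<close>

datatype 'k mat2 = Mat2 (mat11: 'k) (mat12: 'k) (mat21: 'k) (mat22: 'k)

instantiation mat2 :: (comm_ring_1) ring_1
begin

definition zero_mat2 :: "'a mat2" where "0 = Mat2 0 0 0 0"

definition one_mat2 :: "'a mat2" where "1 = Mat2 1 0 0 1"

definition plus_mat2 :: "'a mat2 \<Rightarrow> 'a mat2 \<Rightarrow> 'a mat2" where
  "A + B = Mat2 (mat11 A + mat11 B) (mat12 A + mat12 B) (mat21 A + mat21 B) (mat22 A + mat22 B)"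

definition minus_mat2 :: "'a mat2 \<Rightarrow> 'a mat2 \<Rightarrow> 'a mat2" where
  "A - B = Mat2 (mat11 A - mat11 B) (mat12 A - mat12 B) (mat21 A - mat21 B) (mat22 A - mat22 B)"

definition uminus_mat2 :: "'a mat2 \<Rightarrow> 'a mat2" where
  "- A = Mat2 (- mat11 A) (- mat12 A) (- mat21 A) (- mat22 A)"

definition times_mat2 :: "'a mat2 \<Rightarrow> 'a mat2 \<Rightarrow> 'a mat2" where
  "A * B = Mat2 (mat11 A * mat11 B + mat12 A * mat21 B) (mat11 A * mat12 B + mat12 A * mat22 B)
     (mat21 A * mat11 B + mat22 A * mat21 B) (mat21 A * mat12 B + mat22 A * mat22 B)"

lemmas mat2_defs = zero_mat2_def one_mat2_def plus_mat2_def minus_mat2_def uminus_mat2_def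
  times_mat2_def mat2.expand

instance
  by standard (simp_all add: mat2_defs algebra_simps)

end

lemma mat2_sel [simp]:
  fixes A B :: "'a::comm_ring_1 mat2"
  shows "mat11 (0 :: 'a mat2) = 0" "mat12 (0 :: 'a mat2) = 0"
    "mat21 (0 :: 'a mat2) = 0" "mat22 (0 :: 'a mat2) = 0"
    "mat11 (1 :: 'a mat2) = 1" "mat12 (1 :: 'a mat2) = 0"
    "mat21 (1 :: 'a mat2) = 0" "mat22 (1 :: 'a mat2) = 1"
    "mat11 (A + B) = mat11 A + mat11 B" "mat12 (A + B) = mat12 A + mat12 B"
    "mat21 (A + B) = mat21 A + mat21 B" "mat22 (A + B) = mat22 A + mat22 B"
    "mat11 (A - B) = mat11 A - mat11 B" "mat12 (A - B) = mat12 A - mat12 B"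
    "mat21 (A - B) = mat21 A - mat21 B" "mat22 (A - B) = mat22 A - mat22 B"
    "mat11 (- A) = - mat11 A" "mat12 (- A) = - mat12 A"
    "mat21 (- A) = - mat21 A" "mat22 (- A) = - mat22 A"
    "mat11 (A * B) = mat11 A * mat11 B + mat12 A * mat21 B"
    "mat12 (A * B) = mat11 A * mat12 B + mat12 A * mat22 B"
    "mat21 (A * B) = mat21 A * mat11 B + mat22 A * mat21 B"
    "mat22 (A * B) = mat21 A * mat12 B + mat22 A * mat22 B"
  by (simp_all add: mat2_defs)

lemma mat2_eq_iff:
  "A = B \<longleftrightarrow> mat11 A = mat11 B \<and> mat12 A = mat12 B \<and> mat21 A = mat21 B \<and> mat22 A = mat22 B"
  by (auto intro: mat2.expand)

lemma mat2_sum_sel: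
  fixes f :: "'b \<Rightarrow> 'a::comm_ring_1 mat2"
  shows "mat11 (sum f I) = (\<Sum>i\<in>I. mat11 (f i))" "mat12 (sum f I) = (\<Sum>i\<in>I. mat12 (f i))"
    "mat21 (sum f I) = (\<Sum>i\<in>I. mat21 (f i))" "mat22 (sum f I) = (\<Sum>i\<in>I. mat22 (f i))"
  by (induction I rule: infinite_finite_induct; simp)+

section \<open>Trace, determinant, adjugate and the Cayley-Hamilton identity\<close>

definition mat2_tr :: "'a::comm_ring_1 mat2 \<Rightarrow> 'a" where
  "mat2_tr A = mat11 A + mat22 A"

definition mat2_det :: "'a::comm_ring_1 mat2 \<Rightarrow> 'a" where
  "mat2_det A = mat11 A * mat22 A - mat12 A * mat21 A"

definition scalar_mat2 :: "'a::comm_ring_1 \<Rightarrow> 'a mat2" where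
  "scalar_mat2 c = Mat2 c 0 0 c"

text \<open>The adjugate: an inverse up to the factor \<open>mat2_det A\<close> that is linear in
  \<open>A\<close> and involves no division.\<close>

definition mat2_adj :: "'a::comm_ring_1 mat2 \<Rightarrow> 'a mat2" where
  "mat2_adj A = Mat2 (mat22 A) (- mat12 A) (- mat21 A) (mat11 A)"

lemmas mat2_simps = mat2_eq_iff mat2_tr_def mat2_det_def scalar_mat2_def mat2_adj_def

lemma scalar_mat2_0 [simp]: "scalar_mat2 0 = 0"
  and scalar_mat2_1 [simp]: "scalar_mat2 1 = 1"
  and scalar_mat2_commute: "scalar_mat2 a * A = A * scalar_mat2 a"
  by (simp_all add: mat2_simps mult.commute)

lemma mat2_det_1 [simp]: "mat2_det 1 = 1"
  and mat2_det_mult: "mat2_det (A * B) = mat2_det A * mat2_det B"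
  and mat2_tr_mult_commute: "mat2_tr (A * B) = mat2_tr (B * A)"
  by (simp_all add: mat2_simps algebra_simps)

lemma mat2_tr_sum: "mat2_tr (sum f I) = (\<Sum>i\<in>I. mat2_tr (f i))"
  by (simp add: mat2_tr_def mat2_sum_sel sum.distrib)

lemma mat2_adj_mult: "mat2_adj (A * B) = mat2_adj B * mat2_adj A"
  and mult_mat2_adj: "A * mat2_adj A = scalar_mat2 (mat2_det A)"
  and mat2_adj_mult_self: "mat2_adj A * A = scalar_mat2 (mat2_det A)"
  by (simp_all add: mat2_simps algebra_simps)

lemma mat2_cayley_hamilton:
  "A * A = scalar_mat2 (mat2_tr A) * A - scalar_mat2 (mat2_det A)"
  by (simp add: mat2_simps algebra_simps)

lemma mat2_tr_square: "mat2_tr (A * A) = mat2_tr A * mat2_tr A - 2 * mat2_det A"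
  by (simp add: mat2_simps algebra_simps)

lemma mat2_det_minus_1: "mat2_det (A - 1) = mat2_det A - mat2_tr A + 1"
  by (simp add: mat2_simps algebra_simps)

lemma mat2_det_nonzero_cancel:
  fixes A :: "'a::field mat2"
  assumes "A * B = 0" "mat2_det A \<noteq> 0"
  shows "B = 0"
proof -
  have "scalar_mat2 (mat2_det A) * B = 0"
    using assms(1) by (simp flip: mat2_adj_mult_self add: mult.assoc)
  then show ?thesis using assms(2) by (simp add: mat2_simps)
qed

lemma scalar_mat2_eq_iff [simp]: "scalar_mat2 a = scalar_mat2 b \<longleftrightarrow> a = b"
  by (simp add: scalar_mat2_def)

section \<open>The commutative algebra generated by a nonscalar matrix\<close>

lemma range_scalar_mat2_iff:
  "A \<in> range scalar_mat2 \<longleftrightarrow> mat11 A = mat22 A \<and> mat12 A = 0 \<and> mat21 A = 0"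
proof
  assume "mat11 A = mat22 A \<and> mat12 A = 0 \<and> mat21 A = 0"
  then have "A = scalar_mat2 (mat11 A)" by (simp add: mat2_simps)
  then show "A \<in> range scalar_mat2" by blast
qed (auto simp: scalar_mat2_def)

text \<open>A nonscalar \<open>M\<close> has a nonzero off-diagonal entry or distinct diagonal
  entries. The corresponding quotient determines \<open>b\<close>, the top left entry determines
  \<open>a\<close>, and the commutation equations give the remaining entries. Thus the commutant of
  \<open>M\<close> is \<open>k[M]\<close>.\<close>

lemma commute_nonscalar_mat2:
  fixes A M :: "'a::field mat2"
  assumes "A * M = M * A" and ns: "M \<notin> range scalar_mat2"
  obtains a b where "A = scalar_mat2 a + scalar_mat2 b * M"
proof -
  have "mat11 (A * M) = mat11 (M * A)" "mat12 (A * M) = mat12 (M * A)"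
    "mat21 (A * M) = mat21 (M * A)"
    using assms(1) by simp_all
  then have eq: "mat12 A * mat21 M = mat12 M * mat21 A"
    "mat11 A * mat12 M + mat12 A * mat22 M = mat11 M * mat12 A + mat12 M * mat22 A"
    "mat21 A * mat11 M + mat22 A * mat21 M = mat21 M * mat11 A + mat22 M * mat21 A"
    by (simp_all add: mult.commute)
  consider "mat12 M \<noteq> 0" | "mat21 M \<noteq> 0" | "mat12 M = 0" "mat21 M = 0" "mat11 M \<noteq> mat22 M"
    using ns by (auto simp: range_scalar_mat2_iff)
  then show ?thesis
  proof cases
    case 1
    let ?b = "mat12 A / mat12 M"
    have "A = scalar_mat2 (mat11 A - ?b * mat11 M) + scalar_mat2 ?b * M"
      using 1 eq by (simp add: mat2_simps) (simp add: field_simps)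
    then show ?thesis by (rule that)
  next
    case 2
    let ?b = "mat21 A / mat21 M"
    have "A = scalar_mat2 (mat11 A - ?b * mat11 M) + scalar_mat2 ?b * M"
      using 2 eq by (simp add: mat2_simps) (simp add: field_simps)
    then show ?thesis by (rule that)
  next
    case 3
    let ?b = "(mat11 A - mat22 A) / (mat11 M - mat22 M)"
    have ne: "mat11 M - mat22 M \<noteq> 0" using 3 by simp
    have "mat12 A * (mat11 M - mat22 M) = 0" "mat21 A * (mat11 M - mat22 M) = 0"
      using 3 eq by (auto simp: algebra_simps)
    then have "mat12 A = 0" "mat21 A = 0" using ne by simp_all
    then have "A = scalar_mat2 (mat11 A - ?b * mat11 M) + scalar_mat2 ?b * M"
      using 3 ne by (simp add: mat2_simps) (simp add: divide_simps, simp add: algebra_simps)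
    then show ?thesis by (rule that)
  qed
qed

lemma commutant_nonscalar_mat2_commutes:
  fixes A B M :: "'a::field mat2"
  assumes "A * M = M * A" "B * M = M * B" and ns: "M \<notin> range scalar_mat2"
  shows "A * B = B * A"
proof -
  obtain a b where A: "A = scalar_mat2 a + scalar_mat2 b * M"
    using commute_nonscalar_mat2[OF assms(1) ns] .
  obtain c d where B: "B = scalar_mat2 c + scalar_mat2 d * M"
    using commute_nonscalar_mat2[OF assms(2) ns] .
  show ?thesis
    unfolding A B by (simp add: mat2_simps algebra_simps)
qed

lemma nonscalar_mat2_coeffs_unique:
  fixes M :: "'a::field mat2"
  assumes "M \<notin> range scalar_mat2"
    and "scalar_mat2 a + scalar_mat2 b * M = scalar_mat2 c + scalar_mat2 d * M"
  shows "a = c" "b = d"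
proof -
  have *: "a + b * mat11 M = c + d * mat11 M" "a + b * mat22 M = c + d * mat22 M"
    "b * mat12 M = d * mat12 M" "b * mat21 M = d * mat21 M"
    using assms(2) by (auto simp: mat2_simps)
  have "(b - d) * (mat11 M - mat22 M) = 0"
  proof -
    have "(b - d) * (mat11 M - mat22 M) =
        (a + b * mat11 M) - (c + d * mat11 M) - ((a + b * mat22 M) - (c + d * mat22 M))"
      by (simp add: algebra_simps)
    then show ?thesis using *(1,2) by simp
  qed
  then have "b = d \<or> mat11 M = mat22 M \<and> mat12 M = 0 \<and> mat21 M = 0"
    using *(3,4) by (metis eq_iff_diff_eq_0 mult_cancel_right mult_eq_0_iff)
  then show "b = d" using assms(1) unfolding range_scalar_mat2_iff by blast
  then show "a = c" using *(1) by simp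
qed

lemma of_nat_mat2: "of_nat n = scalar_mat2 (of_nat n)"
  by (induction n) (simp_all add: mat2_simps)

lemma neg_one_mat2: "- 1 = scalar_mat2 (- 1)"
  by (simp add: mat2_simps)

lemma mat2_adj_conv: "mat2_adj A = scalar_mat2 (mat2_tr A) - A"
  by (simp add: mat2_simps)

text \<open>The adjugate swaps the diagonal entries and negates the others; an entry equal to its
  negative vanishes because 2 is invertible.\<close>

lemma self_adjoint_mat2_scalar:
  fixes A :: "'a::field mat2"
  assumes "mat2_adj A = A" and two: "(2::'a) \<noteq> 0"
  shows "A \<in> range scalar_mat2"
proof -
  have zero: "c = 0" if "- c = c" for c :: 'a
  proof -
    have "2 * c = c - (- c)" by simp
    also have "\<dots> = 0" unfolding that by simp
    finally show ?thesis using two by simp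
  qed
  have "mat11 (mat2_adj A) = mat11 A" "mat12 (mat2_adj A) = mat12 A" "mat21 (mat2_adj A) = mat21 A"
    using assms(1) by simp_all
  then have "mat22 A = mat11 A" "mat12 A = 0" "mat21 A = 0"
    by (auto simp: mat2_adj_def intro: zero)
  then show ?thesis by (simp add: range_scalar_mat2_iff)
qed

lemma mat2_tr_affine: "mat2_tr (scalar_mat2 a + scalar_mat2 b * A) = 2 * a + b * mat2_tr A"
  and mat2_det_affine: "mat2_det (scalar_mat2 a + scalar_mat2 b * A) =
    a ^ 2 + a * b * mat2_tr A + b ^ 2 * mat2_det A"
  by (simp_all add: mat2_simps algebra_simps power2_eq_square)

text \<open>Multiplication in \<open>k[A]\<close>, reduced by \<open>A * A = tr A * A - 1\<close>.
  Substituting an eigenvalue for \<open>A\<close> obeys the same rule, which makes such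
  substitutions multiplicative.\<close>

lemma mat2_mult_affine:
  assumes "mat2_det A = 1"
  shows "(scalar_mat2 a + scalar_mat2 b * A) * (scalar_mat2 c + scalar_mat2 d * A) =
    scalar_mat2 (a * c - b * d) + scalar_mat2 (a * d + b * c + b * d * mat2_tr A) * A"
proof -
  have "(scalar_mat2 a + scalar_mat2 b * A) * (scalar_mat2 c + scalar_mat2 d * A) =
    scalar_mat2 (a * c) + scalar_mat2 (a * d + b * c) * A + scalar_mat2 (b * d) * (A * A)"
    by (simp add: mat2_simps algebra_simps)
  also have "A * A = scalar_mat2 (mat2_tr A) * A - 1"
    using mat2_cayley_hamilton[of A] assms by simp
  finally show ?thesis by (simp add: mat2_simps algebra_simps)
qed

section \<open>Matrix groups without nontrivial scalars\<close>

definition mat2_monoid :: "'k::comm_ring_1 mat2 set \<Rightarrow> 'k mat2 monoid" where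
  "mat2_monoid S = \<lparr>carrier = S, monoid.mult = (*), one = 1\<rparr>"

lemma mat2_monoid_sel [simp]:
  "carrier (mat2_monoid S) = S" "A \<otimes>\<^bsub>mat2_monoid S\<^esub> B = A * B" "\<one>\<^bsub>mat2_monoid S\<^esub> = 1"
  by (simp_all add: mat2_monoid_def)

lemma mat2_monoid_pow [simp]: "A [^]\<^bsub>mat2_monoid S\<^esub> (n::nat) = A ^ n"
  by (induction n) (simp_all add: nat_pow_def mat2_monoid_def power_commutes)

lemma order_mat2_monoid [simp]: "Coset.order (mat2_monoid S) = card S"
  by (simp add: Coset.order_def)

text \<open>The condition \<open>card_nonzero\<close> says that the characteristic does not divide
  the order; it rules out unipotent elements and supports averaging arguments. The condition
  \<open>scalar_trivial\<close> is what remains here of extremality.\<close>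

locale mat2_group =
  fixes S :: "'k::field mat2 set"
  assumes group: "group (mat2_monoid S)"
    and finite: "finite S"
    and card_nonzero: "of_nat (card S) \<noteq> (0::'k)"
    and two_nonzero: "(2::'k) \<noteq> 0"
    and scalar_trivial: "A \<in> S \<Longrightarrow> A \<in> range scalar_mat2 \<Longrightarrow> A = 1"
begin

sublocale Gr: group "mat2_monoid S"
  by (rule group)

lemma one_mem: "1 \<in> S"
  using Gr.one_closed by simp

lemma mult_mem: "A \<in> S \<Longrightarrow> B \<in> S \<Longrightarrow> A * B \<in> S"
  using Gr.m_closed by simp

lemma inverse_mem:
  assumes "A \<in> S"
  obtains B where "B \<in> S" "A * B = 1" "B * A = 1"
  using assms that[of "inv\<^bsub>mat2_monoid S\<^esub> A"] Gr.inv_closed[of A] Gr.r_inv[of A] Gr.l_inv[of A]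
  by simp

lemma neg_one_not_mem: "- 1 \<notin> S"
proof
  assume "- 1 \<in> S"
  then have "- 1 = (1 :: 'k mat2)"
    using scalar_trivial[of "- 1"] by (simp add: range_scalar_mat2_iff)
  then show False using two_nonzero by (simp add: mat2_simps)
qed

lemma det_nonzero: "A \<in> S \<Longrightarrow> mat2_det A \<noteq> 0"
  by (metis inverse_mem mat2_det_1 mat2_det_mult mult_zero_left zero_neq_one)

text \<open>By Cayley-Hamilton \<open>A - 1\<close> squares to zero, so
  \<open>A ^ n = 1 + n (A - 1)\<close>. For \<open>n = card S\<close> the left side is 1, while
  \<open>n\<close> is invertible in the field.\<close>

lemma unipotent_eq_one:
  assumes A: "A \<in> S" and "mat2_det A = 1" "mat2_tr A = 2"
  shows "A = 1"
proof -
  have "A * A = scalar_mat2 2 * A - 1"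
    using mat2_cayley_hamilton[of A] assms by simp
  also have "scalar_mat2 2 * A = A + A"
    by (simp add: mat2_simps)
  finally have D: "A * (A - 1) = A - 1"
    by (simp add: algebra_simps)
  have pow: "A ^ n = 1 + of_nat n * (A - 1)" for n
  proof (induction n)
    case (Suc n)
    have "A ^ Suc n = A + A * (of_nat n * (A - 1))"
      by (simp add: Suc.IH distrib_left)
    also have "A * (of_nat n * (A - 1)) = of_nat n * (A * (A - 1))"
      by (metis mult.assoc mult_of_nat_commute)
    finally have "A ^ Suc n = A + of_nat n * (A - 1)" by (simp only: D)
    also have "\<dots> = 1 + of_nat (Suc n) * (A - 1)"
      by (simp add: algebra_simps)
    finally show ?case .
  qed simp
  have "A ^ card S = 1"
    using Gr.pow_order_eq_1[of A] A by simp
  then have "scalar_mat2 (of_nat (card S)) * (A - 1) = 0"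
    using pow[of "card S"] by (simp add: of_nat_mat2)
  moreover have "mat2_det (scalar_mat2 (of_nat (card S) :: 'k)) \<noteq> 0"
    using card_nonzero by (simp add: mat2_simps)
  ultimately have "A - 1 = 0" by (rule mat2_det_nonzero_cancel)
  then show ?thesis by simp
qed

text \<open>Cayley-Hamilton turns \<open>A * A = 1\<close> into \<open>tr A * A = 2\<close>, so
  \<open>A\<close> is scalar.\<close>

lemma involution_not_det_one:
  assumes A: "A \<in> S" "mat2_det A = 1" "A * A = 1"
  shows "A = 1"
proof -
  have "scalar_mat2 (mat2_tr A) * A = scalar_mat2 2"
    using mat2_cayley_hamilton[of A] A by (simp add: mat2_simps algebra_simps)
  then have *: "mat2_tr A * mat11 A = 2" "mat2_tr A * mat12 A = 0"
    "mat2_tr A * mat21 A = 0" "mat2_tr A * mat22 A = 2"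
    by (simp_all add: mat2_eq_iff scalar_mat2_def)
  then have "mat2_tr A \<noteq> 0" using two_nonzero by auto
  then have "mat11 A = mat22 A" "mat12 A = 0" "mat21 A = 0"
    using * by (metis mult_left_cancel, simp_all)
  then show ?thesis using scalar_trivial A by (simp add: range_scalar_mat2_iff)
qed

text \<open>Here \<open>(tr A)^2 - 4\<close> is the discriminant of the characteristic polynomial,
  so \<open>A\<close> has distinct eigenvalues. If it vanished, \<open>A * A\<close> would have
  trace 2 and determinant 1, hence be 1, making \<open>A\<close> an involution of determinant
  1.\<close>

lemma tr_square_neq_4:
  assumes A: "A \<in> S" "mat2_det A = 1" "A \<noteq> 1"
  shows "mat2_tr A ^ 2 \<noteq> 4"
proof
  assume "mat2_tr A ^ 2 = 4"
  then have "mat2_tr (A * A) = 2"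
    using A by (simp add: mat2_tr_square power2_eq_square)
  then have "A * A = 1"
    using A by (intro unipotent_eq_one) (simp_all add: mult_mem mat2_det_mult)
  then show False using involution_not_det_one A by blast
qed

section \<open>The subgroup of determinant 1 is abelian\<close>

definition N :: "'k mat2 set" where
  "N = {A \<in> S. mat2_det A = 1}"

lemma N_mem: "A \<in> N \<Longrightarrow> A \<in> S" "A \<in> N \<Longrightarrow> mat2_det A = 1"
  by (auto simp: N_def)

lemma mult_mem_N: "A \<in> N \<Longrightarrow> B \<in> N \<Longrightarrow> A * B \<in> N"
  by (simp add: N_def mult_mem mat2_det_mult)

lemma adj_mem_N:
  assumes "A \<in> N"
  shows "mat2_adj A \<in> N" "A * mat2_adj A = 1" "mat2_adj A * A = 1"
proof -
  obtain B where B: "B \<in> S" "A * B = 1"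
    using inverse_mem N_mem(1)[OF assms] by metis
  show 1: "A * mat2_adj A = 1" "mat2_adj A * A = 1"
    using N_mem[OF assms] by (simp_all add: mult_mat2_adj mat2_adj_mult_self)
  have "mat2_adj A = mat2_adj A * A * B" using B by (simp add: mult.assoc)
  then have "mat2_adj A = B" using 1 by simp
  moreover have "mat2_det (mat2_adj A) = mat2_det A" by (simp add: mat2_simps mult.commute)
  ultimately show "mat2_adj A \<in> N" using B N_mem(2)[OF assms] by (simp add: N_def)
qed

lemma subgroup_N: "subgroup N (mat2_monoid S)"
proof (rule Gr.subgroupI)
  show "N \<noteq> {}" using one_mem by (auto simp: N_def)
  fix A assume A: "A \<in> N"
  then have "inv\<^bsub>mat2_monoid S\<^esub> A = mat2_adj A"
    using adj_mem_N[OF A] by (intro Gr.inv_equality) (auto simp: N_mem)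
  then show "inv\<^bsub>mat2_monoid S\<^esub> A \<in> N" using adj_mem_N[OF A] by simp
qed (auto simp: N_mem mult_mem_N)

lemma finite_N: "finite N"
  using finite by (simp add: N_def)

lemma card_N_nonzero: "of_nat (card N) \<noteq> (0::'k)"
proof -
  have "card (rcosets\<^bsub>mat2_monoid S\<^esub> N) * card N = card S"
    using Gr.lagrange[OF subgroup_N] by simp
  then show ?thesis using card_nonzero by (metis of_nat_mult mult_zero_right)
qed

text \<open>By Cayley-Hamilton \<open>tr A * A = tr B * B\<close>, and determinants show that the
  traces agree up to sign. Trace zero would give \<open>A * A = - 1\<close>, and opposite traces
  would give \<open>A = - B\<close>; both put \<open>- 1\<close> into \<open>S\<close>.\<close>

lemma square_inj_on_N: "inj_on (\<lambda>A. A * A) N"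
proof (rule inj_onI)
  fix A B assume A: "A \<in> N" and B: "B \<in> N" and eq: "A * A = B * B"
  let ?t = "mat2_tr A" and ?u = "mat2_tr B"
  have "scalar_mat2 ?t * A = scalar_mat2 ?u * B"
    using eq N_mem[OF A] N_mem[OF B] by (simp add: mat2_cayley_hamilton)
  then have ent: "?t * mat11 A = ?u * mat11 B" "?t * mat12 A = ?u * mat12 B"
    "?t * mat21 A = ?u * mat21 B" "?t * mat22 A = ?u * mat22 B"
    by (simp_all add: mat2_eq_iff scalar_mat2_def)
  have "mat2_det (scalar_mat2 ?t * A) = mat2_det (scalar_mat2 ?u * B)"
    using \<open>scalar_mat2 ?t * A = _\<close> by simp
  then have "?t * ?t = ?u * ?u"
    using N_mem[OF A] N_mem[OF B] unfolding mat2_det_mult by (simp add: scalar_mat2_def mat2_det_def)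
  then have cases: "?u = ?t \<or> ?u = - ?t"
    by (metis square_eq_iff)
  show "A = B"
  proof (cases "?t = 0")
    case True
    then have "A * A = - 1"
      using mat2_cayley_hamilton[of A] N_mem[OF A] by simp
    then show ?thesis using mult_mem N_mem(1)[OF A] neg_one_not_mem by metis
  next
    case False
    show ?thesis
    proof (cases "?u = ?t")
      case True
      then show ?thesis using ent False by (simp add: mat2_eq_iff)
    next
      case neg: False
      then have u: "?u = - ?t" using cases by simp
      have "?t * mat11 A = ?t * (- mat11 B)" "?t * mat12 A = ?t * (- mat12 B)"
        "?t * mat21 A = ?t * (- mat21 B)" "?t * mat22 A = ?t * (- mat22 B)"
        using ent unfolding u by simp_all
      then have "A = - B"
        using False by (simp add: mat2_eq_iff del: mult_minus_right)
      moreover obtain C where "C \<in> S" "B * C = 1"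
        using inverse_mem N_mem(1)[OF B] by metis
      ultimately have "- 1 = A * C" by simp
      then show ?thesis using neg_one_not_mem mult_mem N_mem(1)[OF A] \<open>C \<in> S\<close> by metis
    qed
  qed
qed

text \<open>Left multiplication by some \<open>A \<noteq> 1\<close> permutes \<open>N\<close>, so
  \<open>A - 1\<close> annihilates the sum. It is invertible, since
  \<open>det (A - 1) = 2 - tr A\<close> and only the identity in \<open>N\<close> has trace
  2.\<close>

lemma sum_N_eq_zero:
  assumes "N \<noteq> {1}"
  shows "\<Sum>N = 0"
proof -
  have "1 \<in> N" using one_mem by (simp add: N_def)
  then obtain A where A: "A \<in> N" "A \<noteq> 1" using assms by blast
  have bij: "bij_betw ((*) A) N N"
  proof (rule bij_betwI)
    show "(*) A \<in> N \<rightarrow> N" "(*) (mat2_adj A) \<in> N \<rightarrow> N"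
      using A(1) adj_mem_N mult_mem_N by auto
  qed (simp_all add: adj_mem_N[OF A(1)] flip: mult.assoc)
  have "A * \<Sum>N = (\<Sum>B\<in>N. A * B)" by (rule sum_distrib_left)
  also have "\<dots> = \<Sum>N" using sum.reindex_bij_betw[OF bij, of "\<lambda>x. x"] by simp
  finally have "(A - 1) * \<Sum>N = 0" by (simp add: algebra_simps)
  moreover have "mat2_tr A \<noteq> 2" using unipotent_eq_one A N_mem by blast
  then have "mat2_det (A - 1) \<noteq> 0"
    using N_mem(2)[OF A(1)] by (simp add: mat2_det_minus_1)
  ultimately show ?thesis by (rule mat2_det_nonzero_cancel)
qed

text \<open>If only scalars commuted with \<open>N\<close>, orthogonality would give
  \<open>card N\<close> for the sum of squared traces. Since squaring permutes \<open>N\<close> and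
  the traces sum to zero, that sum is also \<open>2 * card N\<close>, a contradiction.\<close>

lemma ex_nonscalar_commuting_N:
  assumes "N \<noteq> {1}"
  shows "\<exists>M. M \<notin> range scalar_mat2 \<and> (\<forall>A\<in>N. A * M = M * A)"
proof (rule ccontr)
  assume "\<not> ?thesis"
  then have schur: "M \<in> range scalar_mat2" if "\<And>A. A \<in> N \<Longrightarrow> A * M = M * A" for M
    using that by blast
  \<comment> \<open>This is conjugation summed over \<open>N\<close>, since the adjugate is the
    inverse there. Reindexing shows that \<open>P E\<close> commutes with \<open>N\<close>, so it is
    a scalar determined by its trace \<open>card N * tr E\<close>.\<close>
  define P where "P E = (\<Sum>A\<in>N. A * E * mat2_adj A)" for E
  have P_comm: "A * P E = P E * A" if A: "A \<in> N" for A E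
  proof -
    have bij: "bij_betw ((*) A) N N"
    proof (rule bij_betwI)
      show "(*) A \<in> N \<rightarrow> N" "(*) (mat2_adj A) \<in> N \<rightarrow> N"
        using A adj_mem_N mult_mem_N by auto
    qed (simp_all add: adj_mem_N[OF A] flip: mult.assoc)
    have "A * P E * mat2_adj A = (\<Sum>B\<in>N. (A * B) * E * mat2_adj (A * B))"
      by (simp add: P_def sum_distrib_left sum_distrib_right mat2_adj_mult mult.assoc)
    also have "\<dots> = P E"
      unfolding P_def using sum.reindex_bij_betw[OF bij, of "\<lambda>B. B * E * mat2_adj B"] by simp
    finally have "A * P E * mat2_adj A * A = P E * A" by simp
    then show ?thesis by (simp add: mult.assoc adj_mem_N[OF A])
  qed
  then have P_scalar: "P E \<in> range scalar_mat2" for E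
    by (rule schur)
  have P_tr: "mat2_tr (P E) = of_nat (card N) * mat2_tr E" for E
  proof -
    have "mat2_tr (A * E * mat2_adj A) = mat2_tr E" if "A \<in> N" for A
      using that by (simp add: mat2_tr_mult_commute[of _ "mat2_adj A"] adj_mem_N flip: mult.assoc)
    then show ?thesis by (simp add: P_def mat2_tr_sum)
  qed
  let ?E11 = "Mat2 1 0 0 0 :: 'k mat2" and ?E12 = "Mat2 0 1 0 0 :: 'k mat2"
    and ?E21 = "Mat2 0 0 1 0 :: 'k mat2" and ?E22 = "Mat2 0 0 0 1 :: 'k mat2"
  have diag: "2 * mat11 (P ?E11) = of_nat (card N)" "2 * mat22 (P ?E22) = of_nat (card N)"
    using P_scalar[of ?E11] P_scalar[of ?E22] P_tr[of ?E11] P_tr[of ?E22]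
    by (simp_all add: range_scalar_mat2_iff mat2_tr_def)
  have off: "mat12 (P ?E12) = 0" "mat21 (P ?E21) = 0"
    using P_scalar[of ?E12] P_scalar[of ?E21] by (simp_all add: range_scalar_mat2_iff)
  \<comment> \<open>For the matrix unit with a 1 in position \<open>(i, j)\<close>, the
    \<open>(i, j)\<close> entry of the conjugate is the product of the \<open>i\<close>-th diagonal
    entry of \<open>A\<close> and the \<open>j\<close>-th of \<open>mat2_adj A\<close>. These add up
    to the product of the two traces, which are equal.\<close>
  have "mat11 (P ?E11) + mat12 (P ?E12) + mat21 (P ?E21) + mat22 (P ?E22) =
      (\<Sum>A\<in>N. mat2_tr A * mat2_tr A)"
    by (simp add: P_def mat2_sum_sel mat2_adj_def mat2_tr_def algebra_simps flip: sum.distrib)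
  then have "2 * (\<Sum>A\<in>N. mat2_tr A * mat2_tr A) =
      2 * mat11 (P ?E11) + 2 * mat22 (P ?E22)"
    using off by (simp add: distrib_left flip: \<open>_ = (\<Sum>A\<in>N. mat2_tr A * mat2_tr A)\<close>)
  then have "2 * (\<Sum>A\<in>N. mat2_tr A * mat2_tr A) = 2 * of_nat (card N)"
    using diag by simp
  then have sq: "(\<Sum>A\<in>N. mat2_tr A * mat2_tr A) = of_nat (card N)"
    using two_nonzero by simp
  \<comment> \<open>Second evaluation: because squaring permutes \<open>N\<close>, the traces of the
    squares sum to the trace of \<open>\<Sum>N\<close>, which is zero.\<close>
  have "(\<lambda>A. A * A) ` N \<subseteq> N" using mult_mem_N by auto
  then have bij: "bij_betw (\<lambda>A. A * A) N N"
    using endo_inj_surj[OF finite_N _ square_inj_on_N] square_inj_on_N by (simp add: bij_betw_def)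
  have "0 = mat2_tr (\<Sum>N)" by (simp add: sum_N_eq_zero[OF assms] mat2_tr_def)
  also have "\<dots> = (\<Sum>A\<in>N. mat2_tr (A * A))"
    using sum.reindex_bij_betw[OF bij, of mat2_tr] by (simp add: mat2_tr_sum)
  also have "\<dots> = (\<Sum>A\<in>N. mat2_tr A * mat2_tr A - 2)"
    by (rule sum.cong) (simp_all add: mat2_tr_square N_mem)
  also have "\<dots> = - of_nat (card N)"
    by (simp add: sum_subtractf sq)
  finally show False using card_N_nonzero by simp
qed

lemma N_commute:
  assumes "A \<in> N" "B \<in> N"
  shows "A * B = B * A"
proof (cases "N = {1}")
  case False
  then obtain M where "M \<notin> range scalar_mat2" "\<And>A. A \<in> N \<Longrightarrow> A * M = M * A"
    using ex_nonscalar_commuting_N by blast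
  then show ?thesis using commutant_nonscalar_mat2_commutes assms by metis
qed (use assms in auto)

section \<open>Conjugates and centralizers of elements of determinant 1; the cyclic case\<close>

definition centralizer :: "'k mat2 \<Rightarrow> 'k mat2 set" where
  "centralizer Z = {A \<in> S. A * Z = Z * A}"

lemma subgroup_centralizer:
  assumes "Z \<in> S"
  shows "subgroup (centralizer Z) (mat2_monoid S)"
proof (rule Gr.subgroupI)
  show "centralizer Z \<noteq> {}" using one_mem by (auto simp: centralizer_def)
next
  fix A assume A: "A \<in> centralizer Z"
  then have AS: "A \<in> S" "A * Z = Z * A" by (auto simp: centralizer_def)
  let ?B = "inv\<^bsub>mat2_monoid S\<^esub> A"
  have B: "?B \<in> S" "A * ?B = 1" "?B * A = 1"
    using AS Gr.inv_closed[of A] Gr.r_inv[of A] Gr.l_inv[of A] by simp_all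
  have "?B * Z = ?B * (Z * A) * ?B" using B by (simp add: mult.assoc)
  also have "\<dots> = Z * ?B" using B AS by (simp flip: mult.assoc AS(2))
  finally show "?B \<in> centralizer Z" using B by (simp add: centralizer_def)
next
  fix A B assume "A \<in> centralizer Z" "B \<in> centralizer Z"
  then have "A * B \<in> S" "A * B * Z = A * (Z * B)" "A * (Z * B) = Z * A * B"
    by (auto simp: centralizer_def mult_mem mult.assoc) (metis mult.assoc)
  then show "A \<otimes>\<^bsub>mat2_monoid S\<^esub> B \<in> centralizer Z"
    by (simp add: centralizer_def mult.assoc)
qed (auto simp: centralizer_def)

lemma group_centralizer:
  assumes "Z \<in> S"
  shows "group (mat2_monoid (centralizer Z))"
  using Gr.subgroup_imp_group[OF subgroup_centralizer[OF assms]] by (simp add: mat2_monoid_def)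

lemma nonscalar_if_neq_1: "Z \<in> S \<Longrightarrow> Z \<noteq> 1 \<Longrightarrow> Z \<notin> range scalar_mat2"
  using scalar_trivial by blast

text \<open>The conjugate lies in the abelian group \<open>N\<close>, hence equals
  \<open>a + b Z\<close>, and it keeps the trace \<open>t\<close> and determinant of
  \<open>Z\<close>. Eliminating \<open>a\<close> leaves \<open>(t^2 - 4) (1 - b^2) = 0\<close>, so
  \<open>b\<close> is 1 or -1, and the trace then gives \<open>a = 0\<close> or
  \<open>a = t\<close>.\<close>

lemma conj_N_cases:
  assumes Z: "Z \<in> N" "Z \<noteq> 1" and g: "g \<in> S" "g' \<in> S" "g * g' = 1" "g' * g = 1"
  shows "g * Z * g' = Z \<or> g * Z * g' = mat2_adj Z"
proof -
  define Y where "Y = g * Z * g'"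
  have ZS: "Z \<in> S" "mat2_det Z = 1" using N_mem Z by auto
  have "mat2_det g * mat2_det g' = 1" using g(3) by (simp flip: mat2_det_mult)
  then have detY: "mat2_det Y = 1" using ZS(2) by (simp add: Y_def mat2_det_mult)
  moreover have "Y \<in> S" using g ZS by (simp add: Y_def mult_mem)
  ultimately have "Y * Z = Z * Y" using N_commute[of Y Z] Z by (simp add: N_def)
  then obtain a b where Y: "Y = scalar_mat2 a + scalar_mat2 b * Z"
    using commute_nonscalar_mat2 nonscalar_if_neq_1[OF ZS(1) Z(2)] by blast
  let ?t = "mat2_tr Z"
  have "mat2_tr Y = mat2_tr (g' * (g * Z))" unfolding Y_def by (rule mat2_tr_mult_commute)
  also have "\<dots> = ?t" using g(4) by (simp flip: mult.assoc)
  finally have tr: "2 * a + b * ?t = ?t" unfolding Y mat2_tr_affine .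
  have det: "a ^ 2 + a * b * ?t + b ^ 2 = 1"
    using detY unfolding Y mat2_det_affine by (simp add: ZS(2))
  have "(?t ^ 2 - 4) * (1 - b ^ 2) = 0"
  proof -
    have a: "2 * a = ?t - b * ?t" using tr by (simp add: algebra_simps)
    \<comment> \<open>The factor 4 makes \<open>a\<close> occur only through \<open>2 * a\<close>,
      for which the trace equation can be substituted.\<close>
    have "4 * (a ^ 2 + a * b * ?t + b ^ 2) = (2 * a) ^ 2 + 2 * (2 * a) * b * ?t + 4 * b ^ 2"
      by (simp add: algebra_simps power2_eq_square)
    then have "4 = (?t - b * ?t) ^ 2 + 2 * (?t - b * ?t) * b * ?t + 4 * b ^ 2"
      unfolding a det by simp
    then show ?thesis by (simp add: algebra_simps power2_eq_square)
  qed
  then have "b ^ 2 = 1" using tr_square_neq_4[OF ZS Z(2)] by simp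
  then consider "b = 1" | "b = - 1" by (auto simp: power2_eq_1_iff)
  then show ?thesis
  proof cases
    case 1
    then have "a = 0" using tr two_nonzero by simp
    then show ?thesis using Y 1 by (simp add: Y_def)
  next
    case 2
    then have "2 * a = 2 * ?t" using tr by (simp add: algebra_simps)
    then have "a = ?t" using two_nonzero by simp
    then have "Y = mat2_adj Z"
      using Y 2 by (simp add: mat2_adj_conv flip: neg_one_mat2)
    then show ?thesis by (simp add: Y_def)
  qed
qed

text \<open>
  On the centralizer, which lies in \<open>k[Z]\<close>, the ratio of the two eigenvalues is injective because
  only the identity is scalar, and Frobenius either fixes or inverts it.
\<close>

lemma centralizer_eigenvalue_ratio:
  assumes Z: "Z \<in> N" "Z \<noteq> 1" and p: "prime CHAR('k)" and frob: "\<And>a::'k. a ^ CHAR('k) = a"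
  obtains f :: "'k mat2 \<Rightarrow> 'k alg_closure" and e :: nat where
    "inj_on f (centralizer Z)" "f 1 = 1"
    "\<And>A B. A \<in> centralizer Z \<Longrightarrow> B \<in> centralizer Z \<Longrightarrow> f (A * B) = f A * f B"
    "\<And>A. A \<in> centralizer Z \<Longrightarrow> f A ^ e = 1"
    "e = CHAR('k) - 1 \<or>
     e = CHAR('k) + 1 \<and> (\<forall>A\<in>centralizer Z. A * A = 1 \<longrightarrow> A = 1)"
proof -
  let ?p = "CHAR('k)" and ?C = "centralizer Z"
  have ZS: "Z \<in> S" "mat2_det Z = 1" using N_mem Z by auto
  have ns: "Z \<notin> range scalar_mat2" by (rule nonscalar_if_neq_1[OF ZS(1) Z(2)])
  have "\<exists>a b. A = scalar_mat2 a + scalar_mat2 b * Z" if "A \<in> ?C" for A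
    using that commute_nonscalar_mat2[OF _ ns] by (auto simp: centralizer_def)
  then obtain \<alpha> \<beta> where coeff: "\<And>A. A \<in> ?C \<Longrightarrow> A = scalar_mat2 (\<alpha> A) + scalar_mat2 (\<beta> A) * Z"
    by metis
  \<comment> \<open>Over the algebraic closure, \<open>l\<close> and \<open>m = t - l\<close> are
    the eigenvalues of \<open>Z\<close>, the roots of \<open>X^2 - t X + 1\<close>.\<close>
  define t where "t = to_ac (mat2_tr Z)"
  obtain l where "poly [:1, - t, 1:] l = 0"
    using alg_closed_imp_poly_has_root[of "[:1, - t, 1:]"] by auto
  then have l: "l * l = t * l - 1" by (simp add: algebra_simps)
  define m where "m = t - l"
  have lm: "l * m = 1" "l + m = t" using l by (simp_all add: m_def algebra_simps)
  have lm_nz: "l \<noteq> 0" "m \<noteq> 0" using lm(1) by auto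
  have m: "m * m = t * m - 1" using lm(1) by (simp add: distrib_right flip: lm(2))
  have "(l - m) ^ 2 = (l + m) ^ 2 - 4 * (l * m)"
    by (simp add: algebra_simps power2_eq_square)
  also have "\<dots> = to_ac (mat2_tr Z ^ 2 - 4)"
    unfolding lm by (simp add: t_def)
  finally have "(l - m) ^ 2 = to_ac (mat2_tr Z ^ 2 - 4)" .
  moreover have "to_ac (mat2_tr Z ^ 2 - 4) \<noteq> 0"
    using tr_square_neq_4[OF ZS Z(2)] unfolding to_ac_eq_0_iff by simp
  ultimately have neq: "l \<noteq> m" by auto
  \<comment> \<open>Evaluation of the polynomial expression for \<open>A\<close> at an eigenvalue
    \<open>c\<close> of \<open>Z\<close>: \<open>\<chi> l\<close> and \<open>\<chi> m\<close> give
    the two eigenvalues of \<open>A\<close>.\<close>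
  define \<chi> where "\<chi> c A = to_ac (\<alpha> A) + to_ac (\<beta> A) * c" for c A
  have C_mult: "A * B \<in> ?C" if "A \<in> ?C" "B \<in> ?C" for A B
    using subgroup.m_closed[OF subgroup_centralizer[OF ZS(1)]] that by simp
  have C_1: "1 \<in> ?C" using one_mem by (simp add: centralizer_def)
  have \<chi>_mult: "\<chi> c (A * B) = \<chi> c A * \<chi> c B"
    if "A \<in> ?C" "B \<in> ?C" and c: "c * c = t * c - 1" for c A B
  proof -
    have "scalar_mat2 (\<alpha> (A * B)) + scalar_mat2 (\<beta> (A * B)) * Z =
        scalar_mat2 (\<alpha> A * \<alpha> B - \<beta> A * \<beta> B) +
        scalar_mat2 (\<alpha> A * \<beta> B + \<beta> A * \<alpha> B + \<beta> A * \<beta> B * mat2_tr Z) * Z"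
      using coeff[OF that(1)] coeff[OF that(2)] coeff[OF C_mult[OF that(1,2)]]
        mat2_mult_affine[OF ZS(2)] by metis
    then have "\<alpha> (A * B) = \<alpha> A * \<alpha> B - \<beta> A * \<beta> B"
      "\<beta> (A * B) = \<alpha> A * \<beta> B + \<beta> A * \<alpha> B + \<beta> A * \<beta> B * mat2_tr Z"
      using nonscalar_mat2_coeffs_unique[OF ns] by blast+
    then have "\<chi> c (A * B) = to_ac (\<alpha> A) * to_ac (\<alpha> B) - to_ac (\<beta> A) * to_ac (\<beta> B) +
        (to_ac (\<alpha> A) * to_ac (\<beta> B) + to_ac (\<beta> A) * to_ac (\<alpha> B) +
         to_ac (\<beta> A) * to_ac (\<beta> B) * t) * c"
      by (simp add: \<chi>_def t_def)
    also have "\<dots> = to_ac (\<alpha> A) * to_ac (\<alpha> B) +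
        (to_ac (\<alpha> A) * to_ac (\<beta> B) + to_ac (\<beta> A) * to_ac (\<alpha> B)) * c +
         to_ac (\<beta> A) * to_ac (\<beta> B) * (c * c)"
      unfolding c by (simp add: algebra_simps)
    also have "\<dots> = \<chi> c A * \<chi> c B"
      by (simp add: \<chi>_def algebra_simps)
    finally show ?thesis .
  qed
  have "\<alpha> 1 = 1" "\<beta> 1 = 0"
    using nonscalar_mat2_coeffs_unique[OF ns, of "\<alpha> 1" "\<beta> 1" 1 0] coeff[OF C_1] by simp_all
  then have \<chi>_1: "\<chi> c 1 = 1" for c by (simp add: \<chi>_def)
  \<comment> \<open>The product of the two eigenvalues is the determinant, which is nonzero.\<close>
  have \<chi>_nz: "\<chi> l A \<noteq> 0" "\<chi> m A \<noteq> 0" if "A \<in> ?C" for A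
  proof -
    have "mat2_det A = \<alpha> A ^ 2 + \<alpha> A * \<beta> A * mat2_tr Z + \<beta> A ^ 2"
      using mat2_det_affine[of "\<alpha> A" "\<beta> A" Z] coeff[OF that] ZS(2) by simp
    then have "to_ac (mat2_det A) = to_ac (\<alpha> A) ^ 2 + to_ac (\<alpha> A) * to_ac (\<beta> A) * t + to_ac (\<beta> A) ^ 2"
      by (simp add: t_def)
    also have "\<dots> = to_ac (\<alpha> A) ^ 2 + to_ac (\<alpha> A) * to_ac (\<beta> A) * (l + m) +
        to_ac (\<beta> A) ^ 2 * (l * m)"
      unfolding lm by simp
    also have "\<dots> = \<chi> l A * \<chi> m A"
      by (simp add: \<chi>_def algebra_simps power2_eq_square)
    finally show "\<chi> l A \<noteq> 0" "\<chi> m A \<noteq> 0"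
      using det_nonzero[of A] that by (auto simp: centralizer_def)
  qed
  define f where "f A = \<chi> l A / \<chi> m A" for A
  have f_mult: "f (A * B) = f A * f B" if "A \<in> ?C" "B \<in> ?C" for A B
    using that l m by (simp add: f_def \<chi>_mult)
  have f_kernel: "A = 1" if A: "A \<in> ?C" and "f A = 1" for A
  proof -
    have "\<chi> l A = \<chi> m A" using that \<chi>_nz by (simp add: f_def)
    then have "to_ac (\<beta> A) * (l - m) = 0" by (simp add: \<chi>_def algebra_simps)
    then have "\<beta> A = 0" using neq by simp
    then have "A \<in> range scalar_mat2" using coeff[OF A] by auto
    then show ?thesis using A scalar_trivial by (auto simp: centralizer_def)
  qed
  have f_1: "f 1 = 1" by (simp add: f_def \<chi>_1)
  have inj: "inj_on f ?C"
  proof (rule inj_onI)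
    fix A B assume A: "A \<in> ?C" and B: "B \<in> ?C" and eq: "f A = f B"
    interpret C: group "mat2_monoid ?C" by (rule group_centralizer[OF ZS(1)])
    let ?B = "inv\<^bsub>mat2_monoid ?C\<^esub> B"
    have inv: "?B \<in> ?C" "B * ?B = 1" "?B * B = 1"
      using B C.inv_closed[of B] C.r_inv[of B] C.l_inv[of B] by simp_all
    have "f (A * ?B) = f (B * ?B)"
      using eq by (simp only: f_mult[OF A inv(1)] f_mult[OF B inv(1)])
    then have "A * ?B = 1" using f_kernel A inv f_1 C_mult by simp
    then have "A * (?B * B) = B" by (simp flip: mult.assoc)
    then show "A = B" using inv by simp
  qed
  have p': "prime CHAR('k alg_closure)" using p by simp
  have to_ac_frob: "to_ac a ^ ?p = to_ac a" for a :: 'k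
    by (simp add: frob flip: to_ac_power)
  have fd: "(a + b) ^ ?p = a ^ ?p + b ^ ?p" for a b :: "'k alg_closure"
    using freshmans_dream[OF p' refl, of a b] by simp
  have \<chi>_frob: "\<chi> c A ^ ?p = \<chi> (c ^ ?p) A" for c A
    by (simp add: \<chi>_def fd power_mult_distrib to_ac_frob)
  \<comment> \<open>Frobenius fixes the coefficients of \<open>X^2 - t X + 1\<close>, so
    \<open>l ^ ?p\<close> is again a root, that is, \<open>l\<close> or \<open>m\<close>.\<close>
  have root: "(l ^ ?p) * (l ^ ?p) + 1 = t * l ^ ?p"
  proof -
    have "(l * l + 1) ^ ?p = (t * l) ^ ?p" using l by simp
    then show ?thesis by (simp add: fd power_mult_distrib to_ac_frob t_def)
  qed
  have "(l ^ ?p - l) * (l ^ ?p - m) = (l ^ ?p) * (l ^ ?p) - (l + m) * l ^ ?p + l * m"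
    by (simp add: algebra_simps)
  also have "\<dots> = 0"
    unfolding lm using root by (simp add: algebra_simps)
  finally have "(l ^ ?p - l) * (l ^ ?p - m) = 0" .
  then consider "l ^ ?p = l" | "l ^ ?p = m" by auto
  then show ?thesis
  proof cases
    \<comment> \<open>Frobenius fixes both eigenvalues of \<open>Z\<close> and hence every ratio, so
      the exponent is \<open>?p - 1\<close>.\<close>
    case 1
    have "l ^ ?p * m ^ ?p = 1" using lm(1) by (simp flip: power_mult_distrib)
    then have "l * m ^ ?p = l * m" using 1 lm(1) by simp
    then have "m ^ ?p = m" using lm_nz by simp
    then have "f A ^ ?p = f A" for A
      using 1 by (simp add: f_def power_divide \<chi>_frob)
    moreover have "f A \<noteq> 0" if "A \<in> ?C" for A using \<chi>_nz[OF that] by (simp add: f_def)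
    moreover have "f A ^ ?p = f A * f A ^ (?p - 1)" for A
      using p by (metis Suc_diff_1 power_Suc prime_gt_0_nat)
    ultimately have "f A ^ (?p - 1) = 1" if "A \<in> ?C" for A
      using that by (metis mult_cancel_left1)
    then show ?thesis using that[of f "?p - 1"] inj f_1 f_mult by blast
  next
    \<comment> \<open>Frobenius swaps \<open>l\<close> and \<open>m\<close>, hence inverts every
      ratio, so the exponent is \<open>?p + 1\<close>.\<close>
    case 2
    have "l ^ ?p * m ^ ?p = 1" using lm(1) by (simp flip: power_mult_distrib)
    then have "m * m ^ ?p = m * l" using 2 lm(1) by (simp add: mult.commute)
    then have ml: "m ^ ?p = l" using lm_nz by simp
    have "f A ^ ?p = inverse (f A)" for A
      using 2 ml by (simp add: f_def power_divide \<chi>_frob)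
    then have pow: "f A ^ (?p + 1) = 1" if "A \<in> ?C" for A
      using \<chi>_nz[OF that] by (simp add: f_def)
    \<comment> \<open>The eigenvalues of an involution are 1 or -1. Frobenius fixes these values but
      swaps the two eigenvalues, so they agree and the ratio is 1.\<close>
    have invol: "A = 1" if A: "A \<in> ?C" "A * A = 1" for A
    proof -
      have "\<chi> l A * \<chi> l A = 1" "\<chi> m A * \<chi> m A = 1"
        using \<chi>_mult[OF A(1) A(1) l] \<chi>_mult[OF A(1) A(1) m] A(2) by (simp_all add: \<chi>_1)
      then have sgn: "\<chi> l A = 1 \<or> \<chi> l A = - 1"
        by (simp add: square_eq_1_iff)
      have "?p \<noteq> 2"
      proof
        assume "?p = 2"
        then have "of_nat 2 = (0::'k)" by (metis of_nat_CHAR)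
        then show False using two_nonzero by simp
      qed
      then have "odd ?p" using p prime_ge_2_nat[OF p] by (intro prime_odd_nat) simp_all
      then have "\<chi> l A ^ ?p = \<chi> l A" using sgn by (metis power_minus_odd power_one)
      then have "\<chi> m A = \<chi> l A" using 2 \<chi>_frob by simp
      then have "f A = 1" using \<chi>_nz[OF A(1)] by (simp add: f_def)
      then show ?thesis using f_kernel A by blast
    qed
    show ?thesis using that[of f "?p + 1"] inj f_1 f_mult pow invol by blast
  qed
qed

text \<open>The eigenvalue ratio embeds the centralizer into the units of a field, so a generator
  exists, and its order divides the exponent \<open>e\<close>. The parity clause for
  \<open>CHAR('k) + 1\<close>, due to the absence of involutions, later excludes this case when 4
  divides the order.\<close>

lemma centralizer_cyclic:
  assumes Z: "Z \<in> N" "Z \<noteq> 1" and p: "prime CHAR('k)" and frob: "\<And>a::'k. a ^ CHAR('k) = a"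
  obtains r where "r \<in> centralizer Z"
    "group.ord (mat2_monoid (centralizer Z)) r = card (centralizer Z)"
    "card (centralizer Z) dvd CHAR('k) - 1 \<or>
     card (centralizer Z) dvd CHAR('k) + 1 \<and> odd (card (centralizer Z))"
proof -
  let ?C = "centralizer Z"
  have ZS: "Z \<in> S" using N_mem Z by auto
  interpret C: group "mat2_monoid ?C" by (rule group_centralizer[OF ZS])
  have fin: "finite (carrier (mat2_monoid ?C))" using finite by (simp add: centralizer_def)
  obtain f :: "'k mat2 \<Rightarrow> 'k alg_closure" and e where f:
    "inj_on f ?C" "f 1 = 1"
    "\<And>A B. A \<in> ?C \<Longrightarrow> B \<in> ?C \<Longrightarrow> f (A * B) = f A * f B"
    "\<And>A. A \<in> ?C \<Longrightarrow> f A ^ e = 1"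
    "e = CHAR('k) - 1 \<or> e = CHAR('k) + 1 \<and> (\<forall>A\<in>?C. A * A = 1 \<longrightarrow> A = 1)"
    using centralizer_eigenvalue_ratio[OF Z p frob] by blast
  obtain r where r: "r \<in> ?C" "C.ord r = card ?C"
    using C.ex_generator_if_embeds_in_field[OF fin, of f] f by auto
  have fpow: "f (r ^ n) = f r ^ n \<and> r ^ n \<in> ?C" for n
    using C.nat_pow_closed[of r n for n] r f C.one_closed
    by (induction n) (simp_all, metis mat2_monoid_sel(1) mat2_monoid_pow power_Suc)
  have "f (r ^ e) = f 1" using fpow f r by simp
  then have "r ^ e = 1" using fpow C.one_closed by (intro inj_onD[OF f(1)]) auto
  then have "card ?C dvd e" using C.pow_eq_id[of r e] r by simp
  moreover have "odd (card ?C)" if "\<forall>A\<in>?C. A * A = 1 \<longrightarrow> A = 1"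
  proof (rule ccontr)
    assume "\<not> odd (card ?C)"
    moreover have "C.ord r > 0" using C.ord_ge_1[OF fin, of r] r by simp
    ultimately obtain z where "z \<in> ?C" "z * z = 1" "z \<noteq> 1"
      using C.generator_involution[of r] r by auto
    then show False using that by blast
  qed
  ultimately show ?thesis using that r f(5) by blast
qed

text \<open>With trivial kernel \<open>N\<close> the determinant is injective, and its values lie in
  the units of the field, where the power \<open>CHAR('k) - 1\<close> is 1.\<close>

lemma cyclic_if_N_trivial:
  assumes "N = {1}" and frob: "\<And>a::'k. a ^ CHAR('k) = a"
  obtains r where "r \<in> S" "Gr.ord r = card S" "card S dvd CHAR('k) - 1"
proof -
  have inj: "inj_on mat2_det S"
  proof (rule inj_onI)
    fix A B assume A: "A \<in> S" and B: "B \<in> S" and eq: "mat2_det A = mat2_det B"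
    obtain C where C: "C \<in> S" "B * C = 1" "C * B = 1" using inverse_mem[OF B] .
    have "mat2_det (A * C) = mat2_det (B * C)" using eq by (simp add: mat2_det_mult)
    then have "A * C \<in> N" using A C by (simp add: N_def mult_mem)
    then have "A * C = 1" using assms(1) by simp
    then have "A * (C * B) = B" by (simp flip: mult.assoc)
    then show "A = B" using C by simp
  qed
  obtain r where r: "r \<in> S" "Gr.ord r = card S"
    using Gr.ex_generator_if_embeds_in_field[of mat2_det] finite inj
    by (auto simp: mat2_det_mult)
  \<comment> \<open>In characteristic 0 the Frobenius hypothesis at 0 would read
    \<open>0 ^ 0 = 0\<close>.\<close>
  have pos: "CHAR('k) > 0"
    using frob[of 0] by (intro Nat.gr0I) auto
  have "mat2_det r * mat2_det r ^ (CHAR('k) - 1) = mat2_det r"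
    using frob[of "mat2_det r"] pos by (metis Suc_diff_1 power_Suc)
  then have "mat2_det r ^ (CHAR('k) - 1) = 1"
    using det_nonzero[OF r(1)] by simp
  moreover have "mat2_det (r ^ n) = mat2_det r ^ n" for n
    by (induction n) (simp_all add: mat2_det_mult)
  moreover have "r ^ n \<in> S" for n
    using Gr.nat_pow_closed[of r n] r by simp
  ultimately have "r ^ (CHAR('k) - 1) \<in> N" by (simp add: N_def)
  then have "r ^ (CHAR('k) - 1) = 1" using assms(1) by simp
  then have "card S dvd CHAR('k) - 1" using Gr.pow_eq_id[of r] r by simp
  then show ?thesis using that r by blast
qed

section \<open>The dihedral case and the resulting dichotomy\<close>

lemma centralizer_ord:
  assumes "Z \<in> S" "A \<in> centralizer Z"
  shows "Gr.ord A = group.ord (mat2_monoid (centralizer Z)) A"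
proof -
  interpret C: group "mat2_monoid (centralizer Z)" by (rule group_centralizer[OF assms(1)])
  have "A \<in> S" using assms by (simp add: centralizer_def)
  then show ?thesis
    using assms(2) Gr.ord_unique[of A "C.ord A"] C.pow_eq_id[of A] by simp
qed

text \<open>Every element of \<open>S\<close> outside the centralizer conjugates \<open>Z\<close> to
  its adjugate, so a product of two such elements centralizes \<open>Z\<close>. Conjugation by
  \<open>w\<close> thus acts on \<open>k[Z]\<close> as the adjugate, from which all the claims
  follow.\<close>

lemma dihedral_structure:
  assumes Z: "Z \<in> N" "Z \<noteq> 1" and w: "w \<in> S" "w \<notin> centralizer Z"
  shows "w * w = 1" and "centralizer Z = N"
    and "A \<in> N \<Longrightarrow> w * A * w = mat2_adj A"
    and "A \<in> S - N \<Longrightarrow> B \<in> S - N \<Longrightarrow> A * B \<in> N"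
proof -
  have ZS: "Z \<in> S" "mat2_det Z = 1" using N_mem Z by auto
  have ns: "Z \<notin> range scalar_mat2" by (rule nonscalar_if_neq_1[OF ZS(1) Z(2)])
  have swap: "A * Z = mat2_adj Z * A" "A * mat2_adj Z = Z * A"
    if A: "A \<in> S" "A \<notin> centralizer Z" for A
  proof -
    obtain A' where A': "A' \<in> S" "A * A' = 1" "A' * A = 1" using inverse_mem[OF A(1)] .
    have "A * Z * A' * A = A * Z" using A' by (simp add: mult.assoc)
    moreover have "A * Z \<noteq> Z * A" using A by (simp add: centralizer_def)
    ultimately show 1: "A * Z = mat2_adj Z * A"
      using conj_N_cases[OF Z A(1) A'] by metis
    have "A * mat2_adj Z = A * scalar_mat2 (mat2_tr Z) - A * Z"
      by (simp add: mat2_adj_conv right_diff_distrib)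
    also have "\<dots> = scalar_mat2 (mat2_tr Z) * A - mat2_adj Z * A"
      by (simp add: 1 scalar_mat2_commute)
    also have "\<dots> = Z * A"
      by (simp add: mat2_adj_conv left_diff_distrib)
    finally show "A * mat2_adj Z = Z * A" .
  qed
  have prod: "A * B \<in> centralizer Z"
    if "A \<in> S" "A \<notin> centralizer Z" "B \<in> S" "B \<notin> centralizer Z" for A B
  proof -
    have "A * B * Z = A * mat2_adj Z * B" using swap(1)[OF that(3,4)] by (simp add: mult.assoc)
    also have "\<dots> = Z * (A * B)" using swap(2)[OF that(1,2)] by (simp add: mult.assoc)
    finally show ?thesis using that by (simp add: centralizer_def mult_mem)
  qed
  \<comment> \<open>The relation for \<open>Z\<close> extends linearly to \<open>k[Z]\<close>, which
    contains the centralizer.\<close>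
  have conj: "w * A = mat2_adj A * w" if "A \<in> centralizer Z" for A
  proof -
    have "A * Z = Z * A" using that by (simp add: centralizer_def)
    then obtain a b where A: "A = scalar_mat2 a + scalar_mat2 b * Z"
      by (rule commute_nonscalar_mat2[OF _ ns])
    have "w * A = scalar_mat2 a * w + scalar_mat2 b * (w * Z)"
      unfolding A by (simp add: distrib_left scalar_mat2_commute mult.assoc)
    also have "\<dots> = (scalar_mat2 a + scalar_mat2 b * mat2_adj Z) * w"
      by (simp add: swap(1)[OF w] distrib_right mult.assoc)
    also have "scalar_mat2 a + scalar_mat2 b * mat2_adj Z = mat2_adj A"
      unfolding A by (simp add: mat2_simps)
    finally show ?thesis .
  qed
  obtain w' where w': "w' \<in> S" "w * w' = 1" "w' * w = 1" using inverse_mem[OF w(1)] .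
  show ww: "w * w = 1"
  proof -
    \<comment> \<open>Since \<open>w * w\<close> commutes with \<open>w\<close> and lies in the
      centralizer, \<open>conj\<close> makes it equal to its own adjugate, hence scalar.\<close>
    have "w * (w * w) = mat2_adj (w * w) * w" by (rule conj[OF prod[OF w w]])
    then have "w * w * w * w' = mat2_adj (w * w) * w * w'" by (simp add: mult.assoc)
    then have "mat2_adj (w * w) = w * w" using w' by (simp add: mult.assoc)
    then have "w * w \<in> range scalar_mat2" using self_adjoint_mat2_scalar two_nonzero by blast
    then show ?thesis using scalar_trivial w(1) mult_mem by blast
  qed
  show CN: "centralizer Z = N"
  proof
    show "N \<subseteq> centralizer Z" using N_commute Z(1) N_mem by (auto simp: centralizer_def)
    show "centralizer Z \<subseteq> N"
    proof
      fix A assume A: "A \<in> centralizer Z"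
      then have AS: "A \<in> S" by (simp add: centralizer_def)
      \<comment> \<open>This product lies in \<open>S\<close> and is scalar, so it is 1 and its
        scalar \<open>det A\<close> is 1.\<close>
      have "A * (w * A * w) = scalar_mat2 (mat2_det A)"
        using conj[OF A] ww by (simp add: mult.assoc mult_mat2_adj)
      moreover have "A * (w * A * w) \<in> S" using AS w(1) mult_mem by simp
      ultimately have "scalar_mat2 (mat2_det A) = scalar_mat2 1"
        using scalar_trivial by (metis rangeI scalar_mat2_1)
      then show "A \<in> N" using AS by (simp add: N_def del: scalar_mat2_1)
    qed
  qed
  show "w * A * w = mat2_adj A" if "A \<in> N"
    using conj[of A] that ww by (simp add: CN mult.assoc)
  show "A * B \<in> N" if "A \<in> S - N" "B \<in> S - N"
    using prod that by (simp add: CN)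
qed

text \<open>Either \<open>N\<close> is trivial, or some \<open>Z \<noteq> 1\<close> in
  \<open>N\<close> is central in \<open>S\<close>, or an element \<open>w\<close> inverts
  \<open>N\<close>, which is then the centralizer and has odd order because it contains no
  involution. The final clause on products outside \<open>N\<close> serves to bound the line
  stabilizer.\<close>

lemma cyclic_or_dihedral:
  assumes p: "prime CHAR('k)" and frob: "\<And>a::'k. a ^ CHAR('k) = a"
  shows "(\<exists>r\<in>S. Gr.ord r = card S \<and>
      (card S dvd CHAR('k) - 1 \<or> card S dvd CHAR('k) + 1 \<and> odd (card S))) \<or>
    (mat2_monoid S \<cong> dihedral_group (card N) \<and> odd (card N) \<and> card N \<ge> 3 \<and>
      (card N dvd CHAR('k) - 1 \<or> card N dvd CHAR('k) + 1) \<and>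
      (\<forall>A\<in>S - N. \<forall>B\<in>S - N. A * B \<in> N))"
proof (cases "N = {1}")
  case True
  then show ?thesis using cyclic_if_N_trivial[OF True frob] by metis
next
  case False
  have "1 \<in> N" using one_mem by (simp add: N_def)
  then obtain Z where Z: "Z \<in> N" "Z \<noteq> 1" using False by blast
  then have ZS: "Z \<in> S" using N_mem by blast
  let ?C = "centralizer Z"
  obtain r where r: "r \<in> ?C" "group.ord (mat2_monoid ?C) r = card ?C"
    "card ?C dvd CHAR('k) - 1 \<or> card ?C dvd CHAR('k) + 1 \<and> odd (card ?C)"
    using centralizer_cyclic[OF Z p frob] .
  have r': "r \<in> S" "Gr.ord r = card ?C"
    using centralizer_ord[OF ZS r(1)] r by (auto simp: centralizer_def)
  show ?thesis
  proof (cases "?C = S")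
    case True
    then show ?thesis using r' r(3) by metis
  next
    case False
    then obtain w where w: "w \<in> S" "w \<notin> ?C" by (auto simp: centralizer_def)
    note D = dihedral_structure[OF Z w]
    have rN: "r \<in> N" and ord: "Gr.ord r = card N" using r(1) r'(2) D(2) by auto
    interpret C: group "mat2_monoid ?C" by (rule group_centralizer[OF ZS])
    have fin: "finite (carrier (mat2_monoid ?C))" using finite by (simp add: centralizer_def)
    have ipow: "r [^]\<^bsub>mat2_monoid ?C\<^esub> a = r [^]\<^bsub>mat2_monoid S\<^esub> a" for a :: int
      using Gr.int_pow_consistent[OF subgroup_centralizer[OF ZS] r(1), of a]
      by (simp add: mat2_monoid_def)
    have "(\<lambda>a::int. r [^]\<^bsub>mat2_monoid ?C\<^esub> a) ` {0..<int (card ?C)} = ?C"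
      using C.carrier_eq_int_powers[OF fin, of r] r by (simp add: bij_betw_def)
    then have powers: "\<exists>a::int. A = r [^]\<^bsub>mat2_monoid S\<^esub> a" if "A \<in> N" for A
      using that unfolding ipow by (auto simp flip: D(2))
    have odd: "odd (card N)"
    proof (rule ccontr)
      assume "\<not> odd (card N)"
      moreover have "C.ord r > 0" using C.ord_ge_1[OF fin, of r] r by simp
      ultimately obtain z where "z \<in> N" "z * z = 1" "z \<noteq> 1"
        using C.generator_involution[of r] r by (auto simp: D(2))
      then show False using involution_not_det_one N_mem by blast
    qed
    moreover have "card N \<noteq> 1"
      using Z \<open>1 \<in> N\<close> by (auto simp: card_1_singleton_iff)
    moreover have "card N \<noteq> 2" using odd by auto
    moreover have "card N \<noteq> 0" using odd by (intro notI) simp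
    ultimately have "card N \<ge> 3" by linarith
    have "mat2_monoid S \<cong> dihedral_group (Gr.ord r)"
    proof (rule Gr.iso_dihedral_group)
      show "finite (carrier (mat2_monoid S))" using finite by simp
      show "r \<in> carrier (mat2_monoid S)" "w \<in> carrier (mat2_monoid S)" using r' w by simp_all
      show "w \<otimes>\<^bsub>mat2_monoid S\<^esub> w = \<one>\<^bsub>mat2_monoid S\<^esub>" using D(1) by simp
      have "inv\<^bsub>mat2_monoid S\<^esub> r = mat2_adj r"
        using adj_mem_N[OF rN] rN by (intro Gr.inv_equality) (auto simp: N_mem)
      then show "w \<otimes>\<^bsub>mat2_monoid S\<^esub> r \<otimes>\<^bsub>mat2_monoid S\<^esub> w = inv\<^bsub>mat2_monoid S\<^esub> r"
        using D(3)[OF rN] by simp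
      show "w \<noteq> r [^]\<^bsub>mat2_monoid S\<^esub> a" for a :: int
        using C.int_pow_closed[of r a] r w by (auto simp: ipow)
      fix A assume A: "A \<in> carrier (mat2_monoid S)"
      show "\<exists>a::int. A = r [^]\<^bsub>mat2_monoid S\<^esub> a \<or>
          A = r [^]\<^bsub>mat2_monoid S\<^esub> a \<otimes>\<^bsub>mat2_monoid S\<^esub> w"
      proof (cases "A \<in> N")
        case True
        then show ?thesis using powers by blast
      next
        case False
        then have "A * w \<in> N" using D(4)[of A w] A w D(2) by simp
        then obtain a :: int where "A * w = r [^]\<^bsub>mat2_monoid S\<^esub> a" using powers by blast
        then have "r [^]\<^bsub>mat2_monoid S\<^esub> a * w = A * (w * w)" by (simp flip: mult.assoc)
        then show ?thesis using D(1) by (intro exI[of _ a]) simp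
      qed
    qed
    then show ?thesis
      using odd \<open>card N \<ge> 3\<close> r(3) D(2,4) ord by auto
  qed
qed

end

section \<open>Matrix groups in coordinates adapted to the line\<close>

text \<open>
  The line \<open>L\<close> is spanned by the first basis vector, so \<open>mat21 A = 0\<close> says that \<open>A\<close> stabilizes
  \<open>L\<close>, and \<open>mat11 A = 1\<close> then says that it fixes \<open>L\<close> pointwise.
\<close>

locale extremal_mat2_group =
  fixes S :: "'k::field mat2 set"
  assumes grp: "group (mat2_monoid S)"
    and fin: "finite S"
    and card_nz: "of_nat (card S) \<noteq> (0::'k)"
    and two_nz: "(2::'k) \<noteq> 0"
    and line: "A \<in> S \<Longrightarrow> mat21 A = 0 \<Longrightarrow> mat11 A = 1"
    and no_invariants: "(\<And>A. A \<in> S \<Longrightarrow> mat11 A * u + mat12 A * v = u \<and> mat21 A * u + mat22 A * v = v)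
      \<Longrightarrow> u = 0 \<and> v = 0"
begin

sublocale mat2_group S
proof (rule mat2_group.intro)
  fix A :: "'k mat2" assume "A \<in> S" "A \<in> range scalar_mat2"
  then show "A = 1" using line[of A] by (simp add: range_scalar_mat2_iff mat2_eq_iff)
qed (fact grp fin card_nz two_nz)+

text \<open>The trivial group fixes every vector. If \<open>S = {1, z}\<close>, then
  \<open>z * z = 1\<close> and the columns of \<open>z + 1\<close> are invariant, hence zero; but
  \<open>- 1\<close> is not in \<open>S\<close>.\<close>

lemma card_ge_3: "card S \<ge> 3"
proof -
  have "card S \<noteq> 0" using fin one_mem by auto
  moreover have "card S \<noteq> 1"
  proof
    assume "card S = 1"
    then have "S = {1}" using one_mem by (auto simp: card_1_singleton_iff)
    then show False using no_invariants[of 1 0] by simp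
  qed
  moreover have "card S \<noteq> 2"
  proof
    assume "card S = 2"
    then obtain z where z: "S = {1, z}" "z \<noteq> 1"
      using one_mem by (auto simp: card_2_iff)
    have "z * z \<noteq> z"
    proof
      assume "z * z = z"
      moreover obtain y where "z * y = 1" using inverse_mem[of z] z by blast
      ultimately show False using z by (metis mult.assoc mult_1_right)
    qed
    then have zz: "z * z = 1" using mult_mem[of z z] z by auto
    then have e: "mat11 z * mat11 z + mat12 z * mat21 z = 1"
      "mat11 z * mat12 z + mat12 z * mat22 z = 0"
      "mat21 z * mat11 z + mat22 z * mat21 z = 0"
      "mat21 z * mat12 z + mat22 z * mat22 z = 1"
      by (simp_all add: mat2_eq_iff)
    have "mat11 z + 1 = 0 \<and> mat21 z = 0"
      using e z by (intro no_invariants) (auto simp: algebra_simps)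
    moreover have "mat12 z = 0 \<and> mat22 z + 1 = 0"
      using e z by (intro no_invariants) (auto simp: algebra_simps)
    ultimately have "z = - 1" by (auto simp: mat2_eq_iff eq_neg_iff_add_eq_0)
    then show False using neg_one_not_mem z by auto
  qed
  ultimately show ?thesis by linarith
qed

text \<open>If \<open>A\<close> fixes the first basis vector and commutes with some \<open>B\<close>
  that moves the line, then \<open>A\<close> fixes two independent vectors and is 1. Otherwise all
  of \<open>S\<close> stabilizes the line, hence fixes it pointwise, contradicting
  \<open>no_invariants\<close>.\<close>

lemma line_stabilizer_trivial_if_commutative:
  assumes comm: "\<And>A B. A \<in> S \<Longrightarrow> B \<in> S \<Longrightarrow> A * B = B * A"
    and A: "A \<in> S" "mat21 A = 0"
  shows "A = 1"
proof (rule ccontr)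
  assume "A \<noteq> 1"
  have A11: "mat11 A = 1" using line A by simp
  have "mat21 B = 0" if B: "B \<in> S" for B
  proof (rule ccontr)
    assume nz: "mat21 B \<noteq> 0"
    have "mat11 (A * B) = mat11 (B * A)" "mat21 (A * B) = mat21 (B * A)"
      using comm[OF A(1) B] by simp_all
    then have "mat12 A = 0" "mat22 A = 1" using nz by (simp_all add: A A11)
    then show False using A A11 \<open>A \<noteq> 1\<close> by (simp add: mat2_eq_iff)
  qed
  then show False using line no_invariants[of 1 0] by simp
qed

text \<open>A stabilizer of the line with determinant 1 is unipotent, hence 1. Nontrivial
  stabilizers therefore lie outside \<open>N\<close>, and any two of them, equal or not, have
  product 1; so there is at most one.\<close>

lemma card_line_stabilizer_le_2:
  assumes "\<And>A B. A \<in> S - N \<Longrightarrow> B \<in> S - N \<Longrightarrow> A * B \<in> N"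
  shows "card {A \<in> S. mat21 A = 0} \<le> 2"
proof -
  let ?H = "{A \<in> S. mat21 A = 0}"
  have triv: "A = 1" if "A \<in> ?H" "A \<in> N" for A
    using that line[of A] N_mem[of A] by (intro unipotent_eq_one) (auto simp: mat2_tr_def mat2_det_def)
  have prod: "A * B = 1" if "A \<in> ?H" "B \<in> ?H" "A \<noteq> 1" "B \<noteq> 1" for A B
    using that triv[of A] triv[of B] assms[of A B] by (intro triv) (auto simp: mult_mem)
  have "A = B" if "A \<in> ?H" "B \<in> ?H" "A \<noteq> 1" "B \<noteq> 1" for A B
  proof -
    have "A * (A * B) = A * A * B" by (simp add: mult.assoc)
    then show ?thesis using prod that by simp
  qed
  then obtain A where "?H \<subseteq> {1, A}" by blast
  then have "card ?H \<le> card {1, A}" by (intro card_mono) auto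
  also have "\<dots> \<le> 2" by (simp add: card_insert_if)
  finally show ?thesis .
qed

end

section \<open>Extremal representations\<close>

text \<open>A basis vector \<open>v\<close> of \<open>L\<close> is completed by \<open>u\<close> to
  a basis of the plane; \<open>c\<close> and \<open>d\<close> are the coordinate functions.\<close>

lemma (in vector_space) two_dim_coordinates:
  assumes dim: "dim (UNIV :: 'b set) = 2" and L: "subspace L" "dim L = 1"
  obtains v c d u where "L = range (\<lambda>k. k *s v)" "\<forall>x. x = c x *s v + d x *s u"
    "\<forall>a b. c (a *s v + b *s u) = a \<and> d (a *s v + b *s u) = b"
proof -
  obtain B where B: "B \<subseteq> L" "independent B" "L \<subseteq> span B" "card B = dim L"
    by (rule basis_exists)
  then obtain v where v: "B = {v}" using L(2) card_1_singletonE by metis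
  have "span B \<subseteq> L" using B(1) L(1) by (rule span_minimal)
  then have Lv: "L = range (\<lambda>k. k *s v)" using B(3) v span_singleton by auto
  obtain B' where B': "{v} \<subseteq> B'" "independent B'" "UNIV \<subseteq> span B'"
    using maximal_independent_subset_extend[of "{v}" UNIV] B(2) v by auto
  have "card B' = 2" using basis_card_eq_dim[of B' UNIV] B' dim by simp
  then obtain u where u: "B' = {u, v}" "u \<noteq> v" using B'(1) by (auto simp: card_2_iff)
  have "u \<notin> span {v}" using B'(2) u by (simp add: independent_insert)
  then have unv: "u \<noteq> k *s v" for k using span_singleton by auto
  have v0: "v \<noteq> 0" using B(2) v by auto
  have ex: "\<exists>a b. x = a *s v + b *s u" for x
  proof -
    have "x \<in> span {u, v}" using B'(3) u by auto
    then obtain b a where "x - b *s u = a *s v"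
      by (auto simp: span_insert span_singleton)
    then have "x = a *s v + b *s u" by (simp add: algebra_simps)
    then show ?thesis by blast
  qed
  then obtain c d where cd: "\<And>x. x = c x *s v + d x *s u" by metis
  have uniq: "a = a' \<and> b = b'" if "a *s v + b *s u = a' *s v + b' *s u" for a b a' b'
  proof -
    have eq: "(b - b') *s u = (a' - a) *s v"
      using that by (simp add: scale_left_diff_distrib algebra_simps)
    have "b = b'"
    proof (rule ccontr)
      assume "b \<noteq> b'"
      then have "u = inverse (b - b') *s ((b - b') *s u)" by simp
      then have "u = (inverse (b - b') * (a' - a)) *s v" unfolding eq by simp
      then show False using unv by blast
    qed
    then show ?thesis using eq v0 by simp
  qed
  show ?thesis
  proof (rule that[of v c d u])
    show "\<forall>a b. c (a *s v + b *s u) = a \<and> d (a *s v + b *s u) = b"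
    proof (intro allI)
      fix a b
      show "c (a *s v + b *s u) = a \<and> d (a *s v + b *s u) = b"
        using uniq[OF cd[of "a *s v + b *s u"]] by simp
    qed
  qed (fact Lv, intro allI, fact cd)
qed

text \<open>In a basis starting with a vector of \<open>L\<close>, the map \<open>M\<close> takes a
  linear map to its matrix. Elements of \<open>H\<close> fix that vector, so their matrices have
  first column \<open>(1, 0)\<close>.\<close>

lemma extremal_representation_matrices:
  fixes G :: "('g, 'm) monoid_scheme" and scale :: "'k::field \<Rightarrow> 'v::ab_group_add \<Rightarrow> 'v"
  assumes V: "extremal_representation G H scale \<rho>"
    and fin: "finite (carrier G)" and ord: "of_nat (Coset.order G) \<noteq> (0::'k)" and two: "(2::'k) \<noteq> 0"
  obtains S and M :: "('v \<Rightarrow> 'v) \<Rightarrow> 'k mat2" where "extremal_mat2_group S"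
    "M \<in> iso (representation_image G scale \<rho>) (mat2_monoid S)"
    "\<And>h. h \<in> H \<Longrightarrow> mat21 (M (\<rho> h)) = 0"
proof -
  let ?R = "representation_image G scale \<rho>"
  have rep: "group_representation G scale \<rho>" and dim: "vector_space.dim scale (UNIV :: 'v set) = 2"
    and inv: "invariants G \<rho> = {0}"
    using V by (auto simp: extremal_representation_def)
  obtain L where L: "module.subspace scale L" "vector_space.dim scale L = 1"
    "H \<subseteq> setwise_stabilizer G \<rho> L" "setwise_stabilizer G \<rho> L = pointwise_stabilizer G \<rho> L"
    using V by (auto simp: extremal_representation_def)
  interpret V: vector_space scale using rep by (simp add: group_representation_def)
  interpret G: group G using rep by (simp add: group_representation_def)
  interpret GL: group "general_linear_group scale"
    by (rule group_general_linear_group) (rule V.vector_space_axioms)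
  interpret \<rho>: group_hom G "general_linear_group scale" \<rho>
    using rep by unfold_locales (simp add: group_representation_def)
  interpret R: group ?R by (rule group_representation_image[OF rep])
  obtain v c d u where Lv: "L = range (\<lambda>k. scale k v)"
    and all: "\<forall>x. x = scale (c x) v + scale (d x) u"
      "\<forall>a b. c (scale a v + scale b u) = a \<and> d (scale a v + scale b u) = b"
    using V.two_dim_coordinates[OF dim L(1,2)] .
  note cd = all(1)[rule_format]
  have c: "c (scale a v + scale b u) = a" and d: "d (scale a v + scale b u) = b" for a b
    using all(2) by blast+
  have R_carrier: "carrier ?R = \<rho> ` carrier G" and R_mult: "f \<otimes>\<^bsub>?R\<^esub> g = f \<circ> g"
    and R_one: "\<one>\<^bsub>?R\<^esub> = id" for f g
    by (simp_all add: representation_image_def general_linear_group_def)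
  have lin: "f (scale a v + scale b u) = scale a (f v) + scale b (f u)" and inj: "f x = 0 \<Longrightarrow> x = 0"
    if "f \<in> carrier ?R" for f a b x
  proof -
    have f: "Vector_Spaces.linear scale scale f" "bij f"
      using that \<rho>.hom_closed by (auto simp: R_carrier general_linear_group_def)
    interpret f: Vector_Spaces.linear scale scale f by (rule f(1))
    show "f (scale a v + scale b u) = scale a (f v) + scale b (f u)"
      by (simp add: f.add f.scale)
    show "f x = 0 \<Longrightarrow> x = 0" using f(2) f.zero by (metis bij_pointE)
  qed
  define M where "M f = Mat2 (c (f v)) (c (f u)) (d (f v)) (d (f u))" for f :: "'v \<Rightarrow> 'v"
  have apply_M: "f (scale a v + scale b u) =
      scale (mat11 (M f) * a + mat12 (M f) * b) v + scale (mat21 (M f) * a + mat22 (M f) * b) u"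
    if "f \<in> carrier ?R" for f a b
  proof -
    have "f (scale a v + scale b u) = scale a (scale (c (f v)) v + scale (d (f v)) u) +
        scale b (scale (c (f u)) v + scale (d (f u)) u)"
      by (simp only: lin[OF that] flip: cd)
    also have "\<dots> = scale (c (f v) * a + c (f u) * b) v + scale (d (f v) * a + d (f u) * b) u"
      by (simp add: V.scale_right_distrib V.scale_left_distrib mult.commute)
    finally show ?thesis by (simp add: M_def)
  qed
  have M_mult: "M (f \<circ> g) = M f * M g" if f: "f \<in> carrier ?R" and g: "g \<in> carrier ?R" for f g
  proof -
    have fg: "f (g x) = scale (c (f v) * c (g x) + c (f u) * d (g x)) v +
        scale (d (f v) * c (g x) + d (f u) * d (g x)) u" for x
      using apply_M[OF f, of "c (g x)" "d (g x)"] unfolding cd[symmetric] by (simp add: M_def)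
    have "c (f (g x)) = c (f v) * c (g x) + c (f u) * d (g x)"
      "d (f (g x)) = d (f v) * c (g x) + d (f u) * d (g x)" for x
      unfolding fg by (rule c d)+
    then show ?thesis by (simp add: M_def mat2_eq_iff)
  qed
  have vu: "c v = 1" "d v = 0" "c u = 0" "d u = 1"
    using c[of 1 0] d[of 1 0] c[of 0 1] d[of 0 1] by simp_all
  have M_id: "M id = 1" by (simp add: M_def vu mat2_eq_iff)
  have M_inj: "inj_on M (carrier ?R)"
  proof (rule inj_onI)
    fix f g assume "f \<in> carrier ?R" "g \<in> carrier ?R" "M f = M g"
    then have "f (scale (c x) v + scale (d x) u) = g (scale (c x) v + scale (d x) u)" for x
      by (simp add: apply_M)
    then have "f x = g x" for x unfolding cd[symmetric] .
    then show "f = g" by (rule ext)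
  qed
  define S where "S = M ` carrier ?R"
  \<comment> \<open>The set of all matrices is not a multiplicative group, but the image of a group
    under a multiplicative map is one, with unit \<open>M id = 1\<close>.\<close>
  have M_hom: "M \<in> hom ?R (mat2_monoid UNIV)"
    by (rule homI) (simp_all add: R_mult M_mult)
  have grp: "group (mat2_monoid S)"
    using R.hom_imp_img_group[OF M_hom] by (simp add: S_def mat2_monoid_def R_one M_id)
  have iso: "M \<in> iso ?R (mat2_monoid S)"
    using M_inj by (auto simp: iso_def hom_def bij_betw_def R_mult M_mult S_def)
  have finR: "finite (carrier ?R)" using fin by (simp add: R_carrier)
  have "card S = card (\<rho> ` carrier G)"
    using card_image[OF M_inj] by (simp add: S_def R_carrier)
  then have "card S dvd Coset.order G" using \<rho>.card_image_dvd_order by simp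
  then have card: "of_nat (card S) \<noteq> (0::'k)"
    using ord by (metis dvdE of_nat_mult mult_zero_left)
  have fixL: "\<rho> g v = v" if "g \<in> setwise_stabilizer G \<rho> L" for g
  proof -
    have "scale 1 v \<in> L" unfolding Lv by blast
    then show ?thesis using that L(4) by (auto simp: pointwise_stabilizer_def)
  qed
  have "extremal_mat2_group S"
  proof (rule extremal_mat2_group.intro)
    show "finite S" using finR by (simp add: S_def)
    fix A assume "A \<in> S" and A0: "mat21 A = 0"
    then obtain g where g: "g \<in> carrier G" "A = M (\<rho> g)" by (auto simp: S_def R_carrier)
    then have gR: "\<rho> g \<in> carrier ?R" by (simp add: R_carrier)
    \<comment> \<open>With \<open>mat21 A = 0\<close>, \<open>\<rho> g\<close> scales
      \<open>v\<close> by \<open>mat11 A\<close>. This factor is nonzero by injectivity, so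
      \<open>\<rho> g\<close> maps \<open>L\<close> onto itself and the extremality of
      \<open>L\<close> applies.\<close>
    have gk: "\<rho> g (scale k v) = scale (mat11 A * k) v" for k
      using apply_M[OF gR, of k 0] A0 by (simp add: g(2))
    have "v \<noteq> 0" using vu c[of 0 0] by auto
    then have "\<rho> g v \<noteq> 0" using inj[OF gR] by blast
    then have nz: "mat11 A \<noteq> 0" using gk[of 1] by auto
    have "\<rho> g ` L = L"
    proof
      show "\<rho> g ` L \<subseteq> L" unfolding Lv by (auto simp: gk)
      show "L \<subseteq> \<rho> g ` L"
      proof
        fix x assume "x \<in> L"
        then obtain k where "x = scale k v" by (auto simp: Lv)
        then have "x = \<rho> g (scale (k / mat11 A) v)" using nz by (simp add: gk)
        then show "x \<in> \<rho> g ` L" by (auto simp: Lv)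
      qed
    qed
    then have "\<rho> g v = v" using fixL g by (simp add: setwise_stabilizer_def)
    then show "mat11 A = 1" using vu by (simp add: g(2) M_def)
  next
    fix a b assume *: "\<And>A. A \<in> S \<Longrightarrow> mat11 A * a + mat12 A * b = a \<and> mat21 A * a + mat22 A * b = b"
    have "\<rho> g (scale a v + scale b u) = scale a v + scale b u" if "g \<in> carrier G" for g
      using apply_M[of "\<rho> g" a b] *[of "M (\<rho> g)"] that by (simp add: S_def R_carrier)
    then have "scale a v + scale b u \<in> invariants G \<rho>" by (simp add: invariants_def)
    then have "scale a v + scale b u = 0" using inv by simp
    then show "a = 0 \<and> b = 0" using c[of a b] d[of a b] c[of 0 0] d[of 0 0] by simp
  qed (fact grp card two)+
  moreover have "mat21 (M (\<rho> h)) = 0" if "h \<in> H" for h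
    using fixL[of h] that L(3) vu by (auto simp: M_def)
  ultimately show ?thesis using that iso by blast
qed

theorem theorem7p11:
  fixes p :: nat
    and G :: "('g, 'm) monoid_scheme"
    and H :: "'g set"
    and scale :: "'p::prime_card mod_ring \<Rightarrow> 'v::ab_group_add \<Rightarrow> 'v"
    and \<rho> :: "'g \<Rightarrow> 'v \<Rightarrow> 'v"
  defines "Gbar \<equiv> representation_image G scale \<rho>"
    and "Hbar \<equiv> \<rho> ` H"
  assumes p: "p = CARD('p)" "p > 2"
    and G: "group G" "finite (carrier G)" "coprime (Coset.order G) p"
    and H: "subgroup H G"
    and V: "extremal_representation G H scale \<rho>"
  shows "((\<exists>d\<ge>3. (d dvd p - 1 \<or> d dvd p + 1) \<and>
             Gbar \<cong> integer_mod_group d \<and> Hbar = {\<one>\<^bsub>Gbar\<^esub>}) \<or>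
          (\<exists>d'\<ge>3. odd d' \<and> (d' dvd p - 1 \<or> d' dvd p + 1) \<and>
             Gbar \<cong> dihedral_group d' \<and> card Hbar \<le> 2)) \<and>
         (\<forall>s. s = multiplicity 2 (Coset.order Gbar) \<longrightarrow> 4 dvd Coset.order Gbar \<longrightarrow> s \<ge> 2 \<longrightarrow>
            [p = 1] (mod 2 ^ s) \<and> cyclic_group Gbar)"
proof -
  have char: "CHAR('p mod_ring) = p" using p by simp
  have prime: "prime p" using prime_card[where 'a = 'p] p by simp
  have "\<not> p dvd Coset.order G"
    using G(3) prime by (metis coprime_common_divisor_nat dvd_refl not_prime_1)
  then have ord: "of_nat (Coset.order G) \<noteq> (0 :: 'p mod_ring)"
    by (simp add: of_nat_eq_0_iff_char_dvd char del: semiring_char_mod_ring)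
  have "\<not> p dvd 2" using p(2) by (auto dest: dvd_imp_le)
  then have "of_nat 2 \<noteq> (0 :: 'p mod_ring)"
    by (simp only: of_nat_eq_0_iff_char_dvd char not_False_eq_True)
  then have two: "(2 :: 'p mod_ring) \<noteq> 0" by simp
  obtain S and M :: "('v \<Rightarrow> 'v) \<Rightarrow> 'p mod_ring mat2" where S: "extremal_mat2_group S"
    and iso: "M \<in> iso Gbar (mat2_monoid S)" and MH: "\<And>h. h \<in> H \<Longrightarrow> mat21 (M (\<rho> h)) = 0"
    using extremal_representation_matrices[OF V G(2) ord two] unfolding Gbar_def by blast
  interpret S: extremal_mat2_group S by (rule S)
  interpret Gbar: group Gbar
    unfolding Gbar_def using V by (intro group_representation_image) (simp add: extremal_representation_def)
  have isoG: "Gbar \<cong> mat2_monoid S" using iso by (rule is_isoI)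
  have order: "Coset.order Gbar = card S"
    using iso_same_card[OF isoG] by (simp add: Coset.order_def)
  have bij: "inj_on M (carrier Gbar)" "M ` carrier Gbar = S" and M1: "M \<one>\<^bsub>Gbar\<^esub> = 1"
    using iso hom_one[OF _ Gbar.is_group S.group, of M] by (auto simp: iso_def bij_betw_def)
  have HG: "Hbar \<subseteq> carrier Gbar"
    using subgroup.subset[OF H] by (auto simp: Hbar_def Gbar_def representation_image_def)
  have MHbar: "M ` Hbar \<subseteq> {A \<in> S. mat21 A = 0}"
    using HG bij(2) MH by (auto simp: Hbar_def)
  have frob: "a ^ CHAR('p mod_ring) = a" for a :: "'p mod_ring"
    using finite_field_power_card_eq_same[of a] by simp
  have "prime CHAR('p mod_ring)" using prime char by simp
  note S.cyclic_or_dihedral[OF this frob, unfolded char]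
  then consider
    (cyclic) r where "r \<in> S" "S.Gr.ord r = card S" "card S dvd p - 1 \<or> card S dvd p + 1 \<and> odd (card S)"
  | (dihedral) "mat2_monoid S \<cong> dihedral_group (card S.N)" "odd (card S.N)" "card S.N \<ge> 3"
      "card S.N dvd p - 1 \<or> card S.N dvd p + 1" "\<And>A B. A \<in> S - S.N \<Longrightarrow> B \<in> S - S.N \<Longrightarrow> A * B \<in> S.N"
    by blast
  then show ?thesis
  proof cases
    case cyclic
    have fin: "finite (carrier (mat2_monoid S))" using S.finite by simp
    have "mat2_monoid S \<cong> integer_mod_group (card S)"
      using S.Gr.iso_integer_mod_group[OF fin, of r] cyclic by simp
    then have 1: "Gbar \<cong> integer_mod_group (card S)" using isoG iso_trans by blast
    have "S \<subseteq> range (\<lambda>n::int. r [^]\<^bsub>mat2_monoid S\<^esub> n)"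
      using S.Gr.carrier_eq_int_powers[OF fin, of r] cyclic by (auto simp: bij_betw_def)
    moreover have "range (\<lambda>n::int. r [^]\<^bsub>mat2_monoid S\<^esub> n) \<subseteq> S"
      using S.Gr.int_pow_closed[of r] cyclic by auto
    ultimately have "cyclic_group (mat2_monoid S)"
      unfolding S.Gr.cyclic_group using cyclic by auto
    then have cyc: "cyclic_group Gbar"
      using isomorphic_group_cyclicity[OF isoG Gbar.is_group S.group] by simp
    have "A * B = B * A" if "A \<in> S" "B \<in> S" for A B
      using comm_groupE(4)[OF S.Gr.cyclic_imp_abelian_group[OF \<open>cyclic_group (mat2_monoid S)\<close>]] that
      by simp
    then have "M ` Hbar \<subseteq> {1}" using MHbar S.line_stabilizer_trivial_if_commutative by blast
    then have "h = \<one>\<^bsub>Gbar\<^esub>" if "h \<in> Hbar" for h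
      using that HG M1 by (intro inj_onD[OF bij(1)]) auto
    moreover have "Hbar \<noteq> {}" using subgroup.one_closed[OF H] by (auto simp: Hbar_def)
    ultimately have 2: "Hbar = {\<one>\<^bsub>Gbar\<^esub>}" by blast
    have "[p = 1] (mod 2 ^ multiplicity 2 (card S))" if "4 dvd card S"
    proof -
      \<comment> \<open>An even order excludes the alternative with \<open>p + 1\<close>, where the
        order is odd.\<close>
      have "even (card S)" using that by (metis dvd_trans even_numeral)
      then have "card S dvd p - 1" using cyclic by blast
      then have "2 ^ multiplicity 2 (card S) dvd p - 1"
        using multiplicity_dvd dvd_trans by blast
      then show ?thesis using p(2) by (simp add: cong_altdef_nat)
    qed
    then show ?thesis using S.card_ge_3 cyclic(3) 1 2 cyc order by auto
  next
    case dihedral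
    have iso2: "Gbar \<cong> dihedral_group (card S.N)" using isoG dihedral(1) iso_trans by blast
    have "card Hbar = card (M ` Hbar)"
      using card_image[OF inj_on_subset[OF bij(1) HG]] by simp
    also have "\<dots> \<le> card {A \<in> S. mat21 A = 0}"
      using S.finite by (intro card_mono[OF _ MHbar]) simp
    also have "\<dots> \<le> 2" using S.card_line_stabilizer_le_2 dihedral(5) by blast
    finally have "card Hbar \<le> 2" .
    \<comment> \<open>The order is twice an odd number, so part (ii) is vacuous in the dihedral
      case.\<close>
    moreover have "Coset.order Gbar = 2 * card S.N"
      using iso_same_card[OF iso2] order_dihedral_group[of "card S.N"] by (simp add: Coset.order_def)
    then have "\<not> 4 dvd Coset.order Gbar" using dihedral(2) by presburger
    ultimately show ?thesis using dihedral iso2 by blast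
  qed
qed

end
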